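(* Work in a saturated model $(\mathcal U,\sigma,D)$ of $DCFA$. Let $G$ be a definable subgroup of $\mathbb G_a^n(\mathcal U)$. If $G$ has infinite dimension, then $SU(G)\ge\omega$.
   Context: All fields have characteristic $0$. A difference-differential field is a field with a derivation $D$ and a field automorphism $\sigma$ commuting with $D$; $\mathcal L_{\sigma,D}=\{0,1,+,-,\cdot,\sigma,D\}$. $DCFA$ is the model companion of the theory of difference-differential fields of characteristic $0$ (its models are the existentially closed ones); its completions are supersimple. $\mathbb G_a$ is the additive group. A tuple $a$ is finite-dimensional over a difference-differential field $E$ if the difference-differential field generated by $E$ and $a$ has finite transcendence degree over $E$, and of infinite dimension otherwise; a group $G$ definable over $E=\mathrm{acl}(E)$ has infinite dimension if a generic of $G$ over $E$ does. $SU(G)$ is the $SU$-rank of $G$, i.e. the $SU$-rank of a generic type of $G$ (a type in $G$ of maximal $SU$-rank). *)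

theory Defs
  imports "HOL-Algebra.Algebra" "HOL-Library.Equipollence"
begin

section \<open>Difference-differential fields of characteristic 0\<close>

record 'a dd_ring = "'a ring" +
  shift :: "'a \<Rightarrow> 'a"
  deriv :: "'a \<Rightarrow> 'a"

locale dd_field = field M for M :: "'a dd_ring" (structure) +
  assumes char_zero: "\<And>k::nat. k > 0 \<Longrightarrow> add_pow M k \<one> \<noteq> \<zero>"
    and shift_iso: "shift M \<in> ring_iso M M"
    and deriv_closed: "x \<in> carrier M \<Longrightarrow> deriv M x \<in> carrier M"
    and deriv_add: "\<lbrakk>x \<in> carrier M; y \<in> carrier M\<rbrakk>
          \<Longrightarrow> deriv M (x \<oplus> y) = deriv M x \<oplus> deriv M y"
    and deriv_mult: "\<lbrakk>x \<in> carrier M; y \<in> carrier M\<rbrakk>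
          \<Longrightarrow> deriv M (x \<otimes> y) = (deriv M x \<otimes> y) \<oplus> (x \<otimes> deriv M y)"
    and shift_deriv: "x \<in> carrier M \<Longrightarrow> shift M (deriv M x) = deriv M (shift M x)"

text \<open>Injectivity is automatic, since the structures concerned are fields.\<close>

definition dd_embedding :: "('a \<Rightarrow> 'b) \<Rightarrow> 'a dd_ring \<Rightarrow> 'b dd_ring \<Rightarrow> bool" where
  "dd_embedding f M N \<longleftrightarrow> f \<in> ring_hom M N \<and>
     (\<forall>x\<in>carrier M. f (shift M x) = shift N (f x) \<and> f (deriv M x) = deriv N (f x))"

definition dd_subfield :: "'a set \<Rightarrow> 'a dd_ring \<Rightarrow> bool" where
  "dd_subfield K M \<longleftrightarrow> subfield K M \<and> shift M ` K = K \<and> deriv M ` K \<subseteq> K"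

definition dd_generated :: "'a dd_ring \<Rightarrow> 'a set \<Rightarrow> 'a set" where
  "dd_generated M S = \<Inter>{K. dd_subfield K M \<and> S \<subseteq> K}"


section \<open>Transcendence degree\<close>

text \<open>The elements of \<open>B\<close> serve as the names of the variables: a polynomial over \<open>K\<close> in
  variables from \<open>B\<close> is evaluated by sending each variable to itself.\<close>

definition (in ring) eval_at_variables :: "('a multiset \<Rightarrow> 'a) \<Rightarrow> 'a" where
  "eval_at_variables P =
     (\<Oplus>m\<in>{m. P m \<noteq> \<zero>}. P m \<otimes> (\<Otimes>x\<in>set_mset m. x [^] count m x))"

definition (in ring) alg_independent :: "'a set \<Rightarrow> 'a set \<Rightarrow> bool" where
  "alg_independent K B \<longleftrightarrow>
     (\<forall>P \<in> indexed_pset B K. eval_at_variables P = \<zero> \<longrightarrow> P = indexed_const \<zero>)"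

definition (in ring) transcendence_basis :: "'a set \<Rightarrow> 'a set \<Rightarrow> 'a set \<Rightarrow> bool" where
  "transcendence_basis K L B \<longleftrightarrow> B \<subseteq> L \<and> alg_independent K B \<and>
     (\<forall>x\<in>L. (algebraic over generate_field R (K \<union> B)) x)"

definition (in ring) finite_trdeg :: "'a set \<Rightarrow> 'a set \<Rightarrow> bool" where
  "finite_trdeg K L \<longleftrightarrow> (\<exists>B. finite B \<and> transcendence_basis K L B)"

definition finite_dimensional_tuple :: "'a dd_ring \<Rightarrow> 'a set \<Rightarrow> 'a list \<Rightarrow> bool" where
  "finite_dimensional_tuple M E a \<longleftrightarrow> ring.finite_trdeg M E (dd_generated M (E \<union> set a))"


section \<open>First-order formulas\<close>

datatype tm = Var nat | Zero | One | Plus tm tm | Minus tm tm | Times tm tm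
  | Shift tm | Deriv tm

datatype fm = Eq tm tm | Not fm | And fm fm | Exists nat fm

primrec tm_val :: "'a dd_ring \<Rightarrow> (nat \<Rightarrow> 'a) \<Rightarrow> tm \<Rightarrow> 'a" where
  "tm_val M v (Var i) = v i"
| "tm_val M v Zero = \<zero>\<^bsub>M\<^esub>"
| "tm_val M v One = \<one>\<^bsub>M\<^esub>"
| "tm_val M v (Plus s t) = tm_val M v s \<oplus>\<^bsub>M\<^esub> tm_val M v t"
| "tm_val M v (Minus s t) = tm_val M v s \<ominus>\<^bsub>M\<^esub> tm_val M v t"
| "tm_val M v (Times s t) = tm_val M v s \<otimes>\<^bsub>M\<^esub> tm_val M v t"
| "tm_val M v (Shift t) = shift M (tm_val M v t)"
| "tm_val M v (Deriv t) = deriv M (tm_val M v t)"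

primrec sat :: "'a dd_ring \<Rightarrow> (nat \<Rightarrow> 'a) \<Rightarrow> fm \<Rightarrow> bool" where
  "sat M v (Eq s t) \<longleftrightarrow> tm_val M v s = tm_val M v t"
| "sat M v (Not p) \<longleftrightarrow> \<not> sat M v p"
| "sat M v (And p q) \<longleftrightarrow> sat M v p \<and> sat M v q"
| "sat M v (Exists i p) \<longleftrightarrow> (\<exists>x\<in>carrier M. sat M (v(i := x)) p)"

primrec qfree :: "fm \<Rightarrow> bool" where
  "qfree (Eq s t) \<longleftrightarrow> True"
| "qfree (Not p) \<longleftrightarrow> qfree p"
| "qfree (And p q) \<longleftrightarrow> qfree p \<and> qfree q"
| "qfree (Exists i p) \<longleftrightarrow> False"

text \<open>The variables \<open>0, 1, \<dots>\<close> take the entries of the list as values. All remaining variables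
  take the value 0, which is named by a constant of the language, so formulas need no side
  condition on their free variables.\<close>

definition holds :: "'a dd_ring \<Rightarrow> fm \<Rightarrow> 'a list \<Rightarrow> bool" where
  "holds M p xs = sat M (\<lambda>i. if i < length xs then xs ! i else \<zero>\<^bsub>M\<^esub>) p"

definition tuples :: "'a dd_ring \<Rightarrow> nat \<Rightarrow> 'a list set" where
  "tuples M n = {a. length a = n \<and> set a \<subseteq> carrier M}"

text \<open>Throughout, a pair \<open>(p, c)\<close> stands for the formula \<open>p(x, c)\<close> with parameters \<open>c\<close>. The
  arity of \<open>x\<close> is supplied by the context.\<close>

definition definable_over :: "'a dd_ring \<Rightarrow> nat \<Rightarrow> 'a set \<Rightarrow> 'a list set \<Rightarrow> bool" where
  "definable_over M n A S \<longleftrightarrow>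
     (\<exists>p c. set c \<subseteq> A \<and> S = {a \<in> tuples M n. holds M p (a @ c)})"

definition tp :: "'a dd_ring \<Rightarrow> 'a set \<Rightarrow> 'a list \<Rightarrow> (fm \<times> 'a list) set" where
  "tp M A a = {(p, c). set c \<subseteq> A \<and> holds M p (a @ c)}"

definition same_type :: "'a dd_ring \<Rightarrow> 'a set \<Rightarrow> 'a list \<Rightarrow> 'a list \<Rightarrow> bool" where
  "same_type M A a b \<longleftrightarrow> length a = length b \<and> tp M A a = tp M A b"

definition acl :: "'a dd_ring \<Rightarrow> 'a set \<Rightarrow> 'a set" where
  "acl M A = {b \<in> carrier M. \<exists>p c. set c \<subseteq> A \<and> holds M p (b # c) \<and>
                finite {x \<in> carrier M. holds M p (x # c)}}"


section \<open>Saturated models of DCFA\<close>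

text \<open>The extension \<open>N\<close> is presented by an embedding and has its universe in the same HOL type
  as \<open>M\<close>. Nothing is lost: a solution \<open>a\<close> in an arbitrary extension already lies in the
  difference-differential subfield generated by \<open>M\<close> and \<open>a\<close>, which has the cardinality
  of \<open>M\<close>.\<close>

definition existentially_closed :: "'a dd_ring \<Rightarrow> bool" where
  "existentially_closed M \<longleftrightarrow>
     (\<forall>(N :: 'a dd_ring) f n p c.
        dd_field N \<and> dd_embedding f M N \<and> qfree p \<and> set c \<subseteq> carrier M \<and>
        (\<exists>a \<in> tuples N n. holds N p (a @ map f c))
        \<longrightarrow> (\<exists>a \<in> tuples M n. holds M p (a @ c)))"

definition DCFA_model :: "'a dd_ring \<Rightarrow> bool" where
  "DCFA_model M \<longleftrightarrow> dd_field M \<and> existentially_closed M"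

definition small :: "'a dd_ring \<Rightarrow> 'a set \<Rightarrow> bool" where
  "small M A \<longleftrightarrow> A \<subseteq> carrier M \<and> A \<prec> carrier M"

definition saturated :: "'a dd_ring \<Rightarrow> bool" where
  "saturated M \<longleftrightarrow>
     (\<forall>A \<Phi>. small M A \<and> (\<forall>(p, c) \<in> \<Phi>. set c \<subseteq> A) \<and>
        (\<forall>\<Phi>'. finite \<Phi>' \<and> \<Phi>' \<subseteq> \<Phi> \<longrightarrow> (\<exists>x\<in>carrier M. \<forall>(p, c) \<in> \<Phi>'. holds M p (x # c)))
        \<longrightarrow> (\<exists>x\<in>carrier M. \<forall>(p, c) \<in> \<Phi>. holds M p (x # c)))"


section \<open>Forking and SU-rank\<close>

text \<open>These definitions are meant for a saturated \<open>M\<close> and small parameter sets. Every complete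
  type over a small set \<open>A\<close> is then of the form \<open>tp M A a\<close>, so types are represented by
  their realizations.\<close>

definition formula_divides :: "'a dd_ring \<Rightarrow> nat \<Rightarrow> 'a set \<Rightarrow> fm \<Rightarrow> 'a list \<Rightarrow> bool" where
  "formula_divides M n A p b \<longleftrightarrow>
     (\<exists>(k::nat) (s :: nat \<Rightarrow> 'a list).
        (\<forall>i. set (s i) \<subseteq> carrier M \<and> same_type M A (s i) b) \<and>
        (\<forall>I. finite I \<and> card I = k \<longrightarrow>
             \<not> (\<exists>x \<in> tuples M n. \<forall>i\<in>I. holds M p (x @ s i))))"

definition formula_forks :: "'a dd_ring \<Rightarrow> nat \<Rightarrow> 'a set \<Rightarrow> fm \<Rightarrow> 'a list \<Rightarrow> bool" where
  "formula_forks M n A p b \<longleftrightarrow>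
     (\<exists>\<Psi>. finite \<Psi> \<and> (\<forall>(q, d) \<in> \<Psi>. set d \<subseteq> carrier M \<and> formula_divides M n A q d) \<and>
        (\<forall>x \<in> tuples M n. holds M p (x @ b) \<longrightarrow> (\<exists>(q, d) \<in> \<Psi>. holds M q (x @ d))))"

text \<open>\<open>tp(a'/B)\<close> is a forking extension of \<open>tp(a/A)\<close>.\<close>

definition forking_extension ::
    "'a dd_ring \<Rightarrow> 'a set \<Rightarrow> 'a list \<Rightarrow> 'a set \<Rightarrow> 'a list \<Rightarrow> bool" where
  "forking_extension M A a B a' \<longleftrightarrow>
     A \<subseteq> B \<and> small M B \<and> set a' \<subseteq> carrier M \<and> same_type M A a a' \<and>
     (\<exists>(p, b) \<in> tp M B a'. formula_forks M (length a) A p b)"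

text \<open>Ordinals are order types of well-orders \<open>r\<close>, and \<open>x \<in> Field r\<close> stands for the order type
  of the set of its strict predecessors. The single clause \<open>SU(p) \<ge> \<alpha>\<close> iff for every
  \<open>\<beta> < \<alpha>\<close> there is a forking extension \<open>q\<close> of \<open>p\<close> with \<open>SU(q) \<ge> \<beta>\<close> covers the usual
  cases: it is void for \<open>\<alpha> = 0\<close>, for \<open>\<alpha> = \<gamma> + 1\<close> only \<open>\<beta> = \<gamma>\<close> matters, and for a
  limit it says \<open>SU(p) \<ge> \<beta> + 1\<close> for all \<open>\<beta> < \<alpha>\<close>.\<close>

inductive SU_ge_at :: "'a dd_ring \<Rightarrow> 'o rel \<Rightarrow> 'o \<Rightarrow> 'a set \<Rightarrow> 'a list \<Rightarrow> bool"
  for M :: "'a dd_ring" and r :: "'o rel" where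
  "(\<And>y. (y, x) \<in> r \<Longrightarrow> y \<noteq> x \<Longrightarrow>
      \<exists>B a'. forking_extension M A a B a' \<and> SU_ge_at M r y B a')
   \<Longrightarrow> SU_ge_at M r x A a"

text \<open>\<open>SU(a/A)\<close> is at least the order type of \<open>r\<close>.\<close>

definition SU_ge :: "'a dd_ring \<Rightarrow> 'o rel \<Rightarrow> 'a set \<Rightarrow> 'a list \<Rightarrow> bool" where
  "SU_ge M r A a \<longleftrightarrow>
     (\<forall>y\<in>Field r. \<exists>B a'. forking_extension M A a B a' \<and> SU_ge_at M r y B a')"

lemma SU_ge_at_natLeq_0: "SU_ge_at M natLeq 0 A a"
  by (rule SU_ge_at.intros) (simp add: natLeq_def)

lemma SU_ge_at_natLeq_mono:
  assumes "SU_ge_at M natLeq k A a" "j \<le> k" shows "SU_ge_at M natLeq j A a"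
  using assms(1)
  by (cases rule: SU_ge_at.cases)
     (rule SU_ge_at.intros, use assms(2) in \<open>auto simp: natLeq_def\<close>)

lemma SU_ge_at_natLeq_Suc:
  "SU_ge_at M natLeq (Suc k) A a \<longleftrightarrow>
     (\<exists>B a'. forking_extension M A a B a' \<and> SU_ge_at M natLeq k B a')"
proof
  assume "SU_ge_at M natLeq (Suc k) A a"
  then show "\<exists>B a'. forking_extension M A a B a' \<and> SU_ge_at M natLeq k B a'"
    by (cases rule: SU_ge_at.cases) (auto simp: natLeq_def)
next
  assume *: "\<exists>B a'. forking_extension M A a B a' \<and> SU_ge_at M natLeq k B a'"
  show "SU_ge_at M natLeq (Suc k) A a"
  proof (rule SU_ge_at.intros)
    fix y assume "(y, Suc k) \<in> natLeq" "y \<noteq> Suc k"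
    then have "y \<le> k" by (auto simp: natLeq_def)
    with * show "\<exists>B a'. forking_extension M A a B a' \<and> SU_ge_at M natLeq y B a'"
      by (blast intro: SU_ge_at_natLeq_mono)
  qed
qed

lemma SU_ge_omega_iff: "SU_ge M natLeq A a \<longleftrightarrow> (\<forall>k. SU_ge_at M natLeq k A a)"
proof -
  have "SU_ge M natLeq A a \<longleftrightarrow> (\<forall>k. SU_ge_at M natLeq (Suc k) A a)"
    by (simp add: SU_ge_def Field_natLeq SU_ge_at_natLeq_Suc)
  also have "\<dots> \<longleftrightarrow> (\<forall>k. SU_ge_at M natLeq k A a)"
    by (metis SU_ge_at_natLeq_0 not0_implies_Suc)
  finally show ?thesis .
qed


section \<open>Definable subgroups of powers of the additive group\<close>

definition Ga_power :: "'a dd_ring \<Rightarrow> nat \<Rightarrow> 'a list monoid" where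
  "Ga_power M n = \<lparr>carrier = tuples M n, monoid.mult = map2 (\<lambda>x y. x \<oplus>\<^bsub>M\<^esub> y),
                   one = replicate n \<zero>\<^bsub>M\<^esub>\<rparr>"

text \<open>A generic of \<open>G\<close> over \<open>E\<close> is an element whose type over \<open>E\<close> has the greatest
  SU-rank. Well-orders on \<open>'a set\<close> suffice to compare ranks: there are at most as many types
  \<open>tp M A a\<close> as there are elements of \<open>'a set\<close> (for infinite \<open>'a\<close>), so every ordinal-valued
  SU-rank is below the successor cardinal of \<open>'a set\<close>.\<close>

definition generic :: "'a dd_ring \<Rightarrow> 'a set \<Rightarrow> 'a list set \<Rightarrow> 'a list \<Rightarrow> bool" where
  "generic M E G a \<longleftrightarrow> a \<in> G \<and>
     (\<forall>b\<in>G. \<forall>r :: 'a set rel. Well_order r \<and> SU_ge M r E b \<longrightarrow> SU_ge M r E a)"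

definition infinite_dimensional :: "'a dd_ring \<Rightarrow> 'a set \<Rightarrow> 'a list set \<Rightarrow> bool" where
  "infinite_dimensional M E G \<longleftrightarrow>
     (\<exists>a. generic M E G a \<and> \<not> finite_dimensional_tuple M E a)"

definition group_SU_ge :: "'a dd_ring \<Rightarrow> 'o rel \<Rightarrow> 'a set \<Rightarrow> 'a list set \<Rightarrow> bool" where
  "group_SU_ge M r E G \<longleftrightarrow> (\<exists>a. generic M E G a \<and> SU_ge M r E a)"

end

theory Submission
  imports Defs
begin

text \<open>Consider the functionals on \<open>G\<close> given by the monomials, that is, by words in the shift and
  the derivation applied to a coordinate.

  If only finitely many of them are linearly independent over the field, then every monomial is a
  linear combination of a finite independent family, with coefficients that are unique, hence in
  \<open>acl E = E\<close>. The difference-differential field generated by \<open>E\<close> and a point of \<open>G\<close> is then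
  generated as a field by finitely many monomials (for the inverse of the shift, use that the
  shifted family is independent as well), so \<open>G\<close> has finite dimension.

  Otherwise one obtains, for each \<open>k\<close>, linear functionals \<open>T\<^sub>1, \<dots>, T\<^sub>k\<close> and points of \<open>G\<close> that are
  in triangular position. Adding constraints \<open>T\<^sub>i x = e\<^sub>i\<close> one by one, every new value \<open>e\<^sub>i\<close> can be
  chosen to be non-algebraic over the previous parameters, since the set of possible values contains
  an infinite arithmetic progression. The formula \<open>T\<^sub>i x = e\<^sub>i\<close> then divides, because its conjugates
  are pairwise inconsistent. This gives a point of rank at least \<open>k\<close> in \<open>G\<close>, and a generic has at
  least this rank.\<close>


text \<open>Independence is taken over the whole field, for restrictions to \<open>G\<close>, so
  coefficients may lie anywhere in the model. In the finite case uniqueness brings them back into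
  \<open>E\<close>, by making them definable. In the infinite case the finitely many coefficients of
  the functionals are put into the base and removed at the end, since enlarging the base cannot
  raise the rank. Triangular position keeps every fiber large. If \<open>T\<^sub>i y\<^sub>i\<close>
  is nonzero and \<open>T\<^sub>i y\<^sub>j = 0\<close> for \<open>j > i\<close>, then the solution
  set of the first constraints is stable under translation by the later \<open>y\<^sub>j\<close>, so
  the next functional still takes infinitely many values on it; characteristic 0 enters here.
  Genericity compares ranks through well-orders on a fixed type, so omega is approached through
  finite ranks, with a separate point of \<open>G\<close> for each \<open>k\<close>.\<close>

section \<open>Transcendence bases of finitely generated extensions\<close>

definition (in ring) monomial_value :: "'a multiset \<Rightarrow> 'a" where
  "monomial_value m = (\<Otimes>x\<in>set_mset m. x [^] count m x)"

lemma (in cring) monomial_value_closed: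
  assumes "set_mset m \<subseteq> carrier R" shows "monomial_value m \<in> carrier R"
  unfolding monomial_value_def using assms by (intro finprod_closed) auto

lemma (in cring) monomial_value_add:
  assumes "set_mset m \<subseteq> carrier R" "i \<in> carrier R"
  shows "monomial_value (add_mset i m) = monomial_value m \<otimes> i"
proof -
  let ?f = "\<lambda>m x. x [^] count m x"
  have "monomial_value (add_mset i m)
      = (\<Otimes>x\<in>insert i (set_mset m - {i}). ?f (add_mset i m) x)"
    unfolding monomial_value_def by (rule finprod_cong) (use assms in \<open>auto simp: insert_absorb\<close>)
  also have "\<dots> = ?f (add_mset i m) i \<otimes> (\<Otimes>x\<in>set_mset m - {i}. ?f (add_mset i m) x)"
    using assms by (subst finprod_insert) auto
  also have "(\<Otimes>x\<in>set_mset m - {i}. ?f (add_mset i m) x) = (\<Otimes>x\<in>set_mset m - {i}. ?f m x)"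
    using assms by (intro finprod_cong) (auto simp: Pi_iff simp_implies_def)
  also have "?f (add_mset i m) i \<otimes> (\<Otimes>x\<in>set_mset m - {i}. ?f m x)
     = (?f m i \<otimes> (\<Otimes>x\<in>set_mset m - {i}. ?f m x)) \<otimes> i"
  proof -
    have "(\<Otimes>x\<in>set_mset m - {i}. ?f m x) \<in> carrier R"
      using assms by (intro finprod_closed) auto
    then show ?thesis using assms(2) by (simp add: m_ac)
  qed
  also have "?f m i \<otimes> (\<Otimes>x\<in>set_mset m - {i}. ?f m x) = monomial_value m"
  proof (cases "i \<in># m")
    case True
    have "monomial_value m = (\<Otimes>x\<in>insert i (set_mset m - {i}). ?f m x)"
      unfolding monomial_value_def by (rule finprod_cong) (use assms True in \<open>auto simp: insert_absorb\<close>)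
    also have "\<dots> = ?f m i \<otimes> (\<Otimes>x\<in>set_mset m - {i}. ?f m x)"
      using assms by (subst finprod_insert) auto
    finally show ?thesis by simp
  next
    case False
    have "(\<Otimes>x\<in>set_mset m. ?f m x) \<in> carrier R"
      using assms by (intro finprod_closed) auto
    moreover have "set_mset m - {i} = set_mset m" "count m i = 0"
      using False by (auto simp: not_in_iff)
    ultimately show ?thesis
      by (simp add: monomial_value_def)
  qed
  finally show ?thesis .
qed

section \<open>Evaluation of polynomials in several variables\<close>

context domain
begin

text \<open>\<open>eval_at_variables\<close> is a sum over the support, which is meaningful only for
  finite support. This predicate collects what such sums need and forgets the set of
  coefficients.\<close>

definition indexed_poly_over :: "'a set \<Rightarrow> ('a multiset \<Rightarrow> 'a) \<Rightarrow> bool" where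
  "indexed_poly_over B P \<longleftrightarrow> finite {m. P m \<noteq> \<zero>} \<and> carrier_coeff P \<and> (\<forall>m. P m \<noteq> \<zero> \<longrightarrow> set_mset m \<subseteq> B)"

lemma indexed_poly_over_pset:
  assumes "K \<subseteq> carrier R" "P \<in> indexed_pset B K" shows "indexed_poly_over B P"
  unfolding indexed_poly_over_def
proof (intro conjI)
  show "carrier_coeff P" using indexed_pset_in_carrier[OF assms] .
  show "finite {m. P m \<noteq> \<zero>}"
    using assms(2)
  proof induction
    case (indexed_const k) then show ?case
      by (rule_tac finite_subset[of _ "{{#}}"]) (auto simp: indexed_const_def)
  next
    case (indexed_padd P Q)
    then show ?case
      by (rule_tac finite_subset[of _ "{m. P m \<noteq> \<zero>} \<union> {m. Q m \<noteq> \<zero>}"]) (auto simp: indexed_padd_def)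
  next
    case (indexed_pmult P i)
    have "{m. indexed_pmult P i m \<noteq> \<zero>} \<subseteq> add_mset i ` {m. P m \<noteq> \<zero>}"
    proof
      fix m assume m: "m \<in> {m. indexed_pmult P i m \<noteq> \<zero>}"
      then have "m = add_mset i (m - {#i#})" "P (m - {#i#}) \<noteq> \<zero>"
        by (auto simp: indexed_pmult_def split: if_splits)
      then show "m \<in> add_mset i ` {m. P m \<noteq> \<zero>}" by blast
    qed
    then show ?case using indexed_pmult by (meson finite_imageI finite_subset)
  qed
  show "\<forall>m. P m \<noteq> \<zero> \<longrightarrow> set_mset m \<subseteq> B"
    using assms(2)
  proof induction
    case (indexed_const k) then show ?case by (auto simp: indexed_const_def)
  next
    case (indexed_padd P Q)
    then show ?case by (auto simp: indexed_padd_def) (metis l_zero subset_iff zero_closed)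
  next
    case (indexed_pmult P i)
    show ?case
    proof (intro allI impI subsetI)
      fix m x assume m: "indexed_pmult P i m \<noteq> \<zero>" "x \<in># m"
      then have "m = add_mset i (m - {#i#})" "P (m - {#i#}) \<noteq> \<zero>"
        by (auto simp: indexed_pmult_def split: if_splits)
      then show "x \<in> B" using m indexed_pmult by (metis insert_iff set_mset_add_mset_insert subset_iff)
    qed
  qed
qed

text \<open>Sums over the supports of different polynomials can be compared only on a common finite
  index set; the added terms vanish.\<close>

lemma eval_at_variables_superset:
  assumes "indexed_poly_over B P" "B \<subseteq> carrier R" "finite F" "{m. P m \<noteq> \<zero>} \<subseteq> F" "\<forall>m\<in>F. set_mset m \<subseteq> B"
  shows "eval_at_variables P = (\<Oplus>m\<in>F. P m \<otimes> monomial_value m)"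
proof -
  have "set_mset m \<subseteq> carrier R" if "m \<in> F" for m using that assms by blast
  then have "(\<lambda>m. P m \<otimes> monomial_value m) \<in> F \<rightarrow> carrier R"
    using assms monomial_value_closed by (auto simp: indexed_poly_over_def carrier_coeff_def)
  then show ?thesis unfolding eval_at_variables_def monomial_value_def[symmetric]
    using assms \<open>\<And>m. m \<in> F \<Longrightarrow> set_mset m \<subseteq> carrier R\<close>
    by (intro add.finprod_mono_neutral_cong_left) (auto simp: monomial_value_closed)
qed

lemma eval_at_variables_padd:
  assumes "indexed_poly_over B P" "indexed_poly_over B Q" "B \<subseteq> carrier R" "indexed_poly_over B (indexed_padd P Q)"
  shows "eval_at_variables (indexed_padd P Q) = eval_at_variables P \<oplus> eval_at_variables Q"
proof -
  let ?F = "{m. P m \<noteq> \<zero>} \<union> {m. Q m \<noteq> \<zero>}"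
  have F: "finite ?F" "\<forall>m\<in>?F. set_mset m \<subseteq> B" using assms by (auto simp: indexed_poly_over_def)
  have c: "monomial_value m \<in> carrier R" if "m \<in> ?F" for m
    using that F assms(3) by (meson monomial_value_closed subset_trans)
  have PQ: "P m \<in> carrier R" "Q m \<in> carrier R" for m using assms by (auto simp: indexed_poly_over_def carrier_coeff_def)
  have "eval_at_variables (indexed_padd P Q) = (\<Oplus>m\<in>?F. indexed_padd P Q m \<otimes> monomial_value m)"
    using assms F by (intro eval_at_variables_superset) (auto simp: indexed_padd_def)
  also have "\<dots> = (\<Oplus>m\<in>?F. (P m \<otimes> monomial_value m) \<oplus> (Q m \<otimes> monomial_value m))"
    using c PQ by (intro add.finprod_cong') (auto simp: indexed_padd_def l_distr)
  also have "\<dots> = (\<Oplus>m\<in>?F. P m \<otimes> monomial_value m) \<oplus> (\<Oplus>m\<in>?F. Q m \<otimes> monomial_value m)"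
    using c PQ by (intro finsum_addf) auto
  also have "(\<Oplus>m\<in>?F. P m \<otimes> monomial_value m) = eval_at_variables P"
    using assms F by (intro eval_at_variables_superset[symmetric]) auto
  also have "(\<Oplus>m\<in>?F. Q m \<otimes> monomial_value m) = eval_at_variables Q"
    using assms F by (intro eval_at_variables_superset[symmetric]) auto
  finally show ?thesis .
qed

text \<open>Multiplication by a variable moves the support along the injective map
  \<open>add_mset i\<close>, so the sum can be reindexed.\<close>

lemma eval_at_variables_pmult:
  assumes "indexed_poly_over B P" "B \<subseteq> carrier R" "i \<in> B"
  shows "eval_at_variables (indexed_pmult P i) = eval_at_variables P \<otimes> i"
proof -
  let ?F = "{m. P m \<noteq> \<zero>}"
  have F: "finite ?F" "\<forall>m\<in>?F. set_mset m \<subseteq> B" using assms by (auto simp: indexed_poly_over_def)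
  have c: "monomial_value m \<in> carrier R" "set_mset m \<subseteq> carrier R" if "m \<in> ?F" for m
    using that F assms(2) by (meson monomial_value_closed subset_trans)+
  have P: "P m \<in> carrier R" for m using assms by (auto simp: indexed_poly_over_def carrier_coeff_def)
  have i: "i \<in> carrier R" using assms by auto
  have supp: "{m. indexed_pmult P i m \<noteq> \<zero>} = add_mset i ` ?F"
  proof
    show "{m. indexed_pmult P i m \<noteq> \<zero>} \<subseteq> add_mset i ` ?F"
    proof
      fix m assume m: "m \<in> {m. indexed_pmult P i m \<noteq> \<zero>}"
      then have "m = add_mset i (m - {#i#})" "P (m - {#i#}) \<noteq> \<zero>"
        by (auto simp: indexed_pmult_def split: if_splits)
      then show "m \<in> add_mset i ` ?F" by blast
    qed
  qed (auto simp: indexed_pmult_def)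
  have "eval_at_variables (indexed_pmult P i)
     = (\<Oplus>m\<in>add_mset i ` ?F. indexed_pmult P i m \<otimes> monomial_value m)"
    unfolding eval_at_variables_def monomial_value_def[symmetric] supp ..
  also have "\<dots> = (\<Oplus>m\<in>?F. indexed_pmult P i (add_mset i m) \<otimes> monomial_value (add_mset i m))"
    using F c P i by (intro finsum_reindex) (auto simp: indexed_pmult_def monomial_value_add inj_on_def)
  also have "\<dots> = (\<Oplus>m\<in>?F. (P m \<otimes> monomial_value m) \<otimes> i)"
    using F c P i by (intro add.finprod_cong') (auto simp: indexed_pmult_def monomial_value_add m_assoc)
  also have "\<dots> = (\<Oplus>m\<in>?F. P m \<otimes> monomial_value m) \<otimes> i"
    using F c P i by (intro finsum_ldistr[symmetric]) auto
  finally show ?thesis unfolding eval_at_variables_def monomial_value_def[symmetric] .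
qed

lemma eval_at_variables_const:
  assumes "k \<in> carrier R" shows "eval_at_variables (indexed_const k) = k"
proof -
  have "eval_at_variables (indexed_const k) = (\<Oplus>m\<in>{{#}}. indexed_const k m \<otimes> monomial_value m)"
    using assms by (intro eval_at_variables_superset[of "{}"] indexed_poly_over_pset[of "carrier R"]
      indexed_pset.indexed_const) (auto simp: indexed_const_def)
  also have "\<dots> = k" using assms by (simp add: indexed_const_def monomial_value_def)
  finally show ?thesis .
qed

lemma eval_at_variables_in_generate_field:
  assumes K: "K \<subseteq> carrier R" and B: "B \<subseteq> carrier R" and P: "P \<in> indexed_pset B K"
  shows "eval_at_variables P \<in> generate_field R (K \<union> B)"
  using P
proof induction
  case (indexed_const k)
  then show ?case using K by (auto simp: eval_at_variables_const generate_field.incl)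
next
  case (indexed_padd P Q)
  then have "eval_at_variables (indexed_padd P Q) = eval_at_variables P \<oplus> eval_at_variables Q"
    using K B by (intro eval_at_variables_padd[of B] indexed_poly_over_pset[OF K]) (auto intro: indexed_pset.indexed_padd)
  then show ?case using indexed_padd by (auto intro: generate_field.eng_add)
next
  case (indexed_pmult P i)
  then have "eval_at_variables (indexed_pmult P i) = eval_at_variables P \<otimes> i"
    using K B by (intro eval_at_variables_pmult[of B] indexed_poly_over_pset[OF K]) auto
  then show ?case using indexed_pmult by (auto intro: generate_field.eng_mult generate_field.incl)
qed

section \<open>Polynomials in one more variable, expanded in that variable\<close>

lemma indexed_pmult_commute:
  "indexed_pmult (indexed_pmult P i) j = indexed_pmult (indexed_pmult P j) i"
proof (rule ext)
  fix m
  have "m - {#i#} - {#j#} = m - {#j#} - {#i#}" by (rule diff_right_commute)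
  moreover have "i \<in># m \<and> j \<in># m - {#i#} \<longleftrightarrow> j \<in># m \<and> i \<in># m - {#j#}"
    by (cases "i = j") (auto simp: in_diff_count)
  ultimately show "indexed_pmult (indexed_pmult P i) j m = indexed_pmult (indexed_pmult P j) i m"
    unfolding indexed_pmult_def by auto
qed

lemma indexed_pmult_padd:
  "indexed_pmult (indexed_padd P Q) i = indexed_padd (indexed_pmult P i) (indexed_pmult Q i)"
  by (rule ext) (auto simp: indexed_pmult_def indexed_padd_def)

text \<open>\<open>indexed_eval_aux\<close> evaluates a list of coefficients by Horner's scheme,
  constant coefficient first. Addition is coefficientwise and keeps the tail of the longer list;
  hence the existential form.\<close>

lemma indexed_eval_aux_padd:
  assumes "K \<subseteq> carrier R" "set Ps \<subseteq> indexed_pset B K" "set Qs \<subseteq> indexed_pset B K"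
  shows "\<exists>Rs. set Rs \<subseteq> indexed_pset B K \<and>
     indexed_padd (indexed_eval_aux Ps s) (indexed_eval_aux Qs s) = indexed_eval_aux Rs s"
proof -
  have cc: "carrier_coeff (indexed_eval_aux Ps s)" if "set Ps \<subseteq> indexed_pset B K" for Ps
    using that indexed_pset_in_carrier[OF assms(1)]
    by (intro indexed_eval_aux_in_carrier) (auto simp: list_all_iff)
  show ?thesis
    using assms(2,3)
  proof (induction Ps arbitrary: Qs)
    case Nil
    show ?case using cc[of Qs] Nil indexed_padd_zero by (intro exI[of _ Qs]) auto
  next
    case (Cons P Ps)
    have cP: "carrier_coeff (indexed_eval_aux (P # Ps) s)" "carrier_coeff P" "carrier_coeff (indexed_eval_aux Ps s)"
      using Cons.prems cc indexed_pset_in_carrier[OF assms(1)] by (auto simp del: indexed_eval_aux.simps)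
    show ?case
    proof (cases Qs)
      case Nil
      then show ?thesis using cP(1) Cons.prems indexed_padd_zero by (intro exI[of _ "P # Ps"]) auto
    next
      case (Cons Q Qs')
      then obtain Rs where Rs: "set Rs \<subseteq> indexed_pset B K"
        "indexed_padd (indexed_eval_aux Ps s) (indexed_eval_aux Qs' s) = indexed_eval_aux Rs s"
        using Cons.IH[of Qs'] Cons.prems by auto
      have cQ: "carrier_coeff Q" "carrier_coeff (indexed_eval_aux Qs' s)"
        using Cons Cons.prems cc indexed_pset_in_carrier[OF assms(1)] by (auto simp del: indexed_eval_aux.simps)
      have e: "indexed_eval_aux (P # Ps) s = indexed_padd (indexed_pmult (indexed_eval_aux Ps s) s) P" for P Ps
        by simp
      have "indexed_padd (indexed_eval_aux (P # Ps) s) (indexed_eval_aux Qs s)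
        = indexed_padd (indexed_pmult (indexed_padd (indexed_eval_aux Ps s) (indexed_eval_aux Qs' s)) s) (indexed_padd P Q)"
        using cP cQ unfolding Cons
        by (intro ext) (auto simp: e indexed_padd_def indexed_pmult_def carrier_coeff_def a_ac simp del: indexed_eval_aux.simps)
      also have "\<dots> = indexed_eval_aux (indexed_padd P Q # Rs) s"
        unfolding Rs(2) by simp
      finally show ?thesis using Rs(1) Cons Cons.prems
        by (intro exI[of _ "indexed_padd P Q # Rs"]) (auto intro: indexed_pset.indexed_padd)
    qed
  qed
qed

text \<open>This reads an element of \<open>K[B, s]\<close> as one of \<open>K[B][s]\<close>, in
  order to turn a dependence of \<open>insert s B\<close> into a univariate equation for
  \<open>s\<close>. A factor \<open>s\<close> prepends a zero coefficient; any other variable is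
  multiplied into every coefficient.\<close>

lemma indexed_pset_insertE:
  assumes K: "K \<subseteq> carrier R" "\<zero> \<in> K" and P: "P \<in> indexed_pset (insert s B) K"
  obtains Qs where "set Qs \<subseteq> indexed_pset B K" "P = indexed_eval_aux Qs s"
proof -
  have "\<exists>Qs. set Qs \<subseteq> indexed_pset B K \<and> P = indexed_eval_aux Qs s"
    using P
  proof induction
    case (indexed_const k)
    then show ?case using indexed_const K
      by (intro exI[of _ "[indexed_const k]"]) (auto simp: indexed_padd_const intro: indexed_pset.indexed_const)
  next
    case (indexed_padd P Q)
    then obtain Ps Qs where "set Ps \<subseteq> indexed_pset B K" "P = indexed_eval_aux Ps s"
        "set Qs \<subseteq> indexed_pset B K" "Q = indexed_eval_aux Qs s" by (elim exE conjE)
    then show ?case using indexed_eval_aux_padd[OF K(1), of Ps B Qs s] by (simp only:)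
  next
    case (indexed_pmult P i)
    from indexed_pmult.IH obtain Qs where "set Qs \<subseteq> indexed_pset B K \<and> P = indexed_eval_aux Qs s" ..
    then have Qs: "set Qs \<subseteq> indexed_pset B K" "P = indexed_eval_aux Qs s" by simp_all
    show ?case
    proof (cases "i = s")
      case True
      have "carrier_coeff (indexed_pmult P i)"
        by (rule indexed_pmult_in_carrier[OF indexed_pset_in_carrier[OF K(1) indexed_pmult.hyps(1)]])
      then show ?thesis using True Qs K(2)
        by (intro exI[of _ "indexed_const \<zero> # Qs"]) (auto simp: indexed_padd_zero intro: indexed_pset.indexed_const)
    next
      case False
      have "indexed_pmult (indexed_eval_aux Qs s) i = indexed_eval_aux (map (\<lambda>Q. indexed_pmult Q i) Qs) s"
        by (induction Qs) (auto simp: indexed_pmult_padd indexed_pmult_commute[of _ s i])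
      then show ?thesis using False Qs indexed_pmult.hyps(2)
        by (intro exI[of _ "map (\<lambda>Q. indexed_pmult Q i) Qs"]) (auto intro: indexed_pset.indexed_pmult)
    qed
  qed
  then show ?thesis using that by blast
qed

lemma indexed_eval_aux_in_pset:
  assumes "\<zero> \<in> K" "set Qs \<subseteq> indexed_pset B K"
  shows "indexed_eval_aux Qs s \<in> indexed_pset (insert s B) K"
proof -
  have mono: "Q \<in> indexed_pset (insert s B) K" if "Q \<in> indexed_pset B K" for Q
    using that by induction (auto intro: indexed_pset.intros)
  show ?thesis using assms
    by (induction Qs) (auto intro: indexed_pset.intros mono)
qed

text \<open>The reversal reconciles two conventions: \<open>indexed_eval_aux\<close> reads the
  constant coefficient first, \<open>eval\<close> the leading one.\<close>

lemma eval_at_variables_indexed_eval_aux: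
  assumes K: "K \<subseteq> carrier R" "\<zero> \<in> K" and B: "insert s B \<subseteq> carrier R" and Qs: "set Qs \<subseteq> indexed_pset B K"
  shows "eval_at_variables (indexed_eval_aux Qs s) = eval (rev (map eval_at_variables Qs)) s"
  using Qs
proof (induction Qs)
  case Nil
  show ?case using eval_at_variables_const[of \<zero>] by simp
next
  case (Cons Q Qs)
  have mono: "Q \<in> indexed_pset (insert s B) K" if "Q \<in> indexed_pset B K" for Q
    using that by induction (auto intro: indexed_pset.intros)
  have cl: "eval_at_variables Q \<in> carrier R" if "Q \<in> indexed_pset (insert s B) K" for Q
    using that
  proof induction
    case (indexed_const k) then show ?case using K by (auto simp: eval_at_variables_const)
  next
    case (indexed_padd P Q) then show ?case
      using eval_at_variables_padd[OF _ _ B, of P Q] indexed_poly_over_pset[OF K(1)] indexed_pset.indexed_padd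
      by (metis add.m_closed)
  next
    case (indexed_pmult P i) then show ?case
      using eval_at_variables_pmult[OF _ B, of P i] indexed_poly_over_pset[OF K(1)] B by auto
  qed
  let ?P = "indexed_eval_aux Qs s"
  have P: "?P \<in> indexed_pset (insert s B) K" using Cons.prems K indexed_eval_aux_in_pset by auto
  have "eval_at_variables (indexed_eval_aux (Q # Qs) s) = eval_at_variables (indexed_padd (indexed_pmult ?P s) Q)"
    by simp
  also have "\<dots> = eval_at_variables (indexed_pmult ?P s) \<oplus> eval_at_variables Q"
    using P mono[of Q] Cons.prems
    by (intro eval_at_variables_padd[OF _ _ B] indexed_poly_over_pset[OF K(1)]) (auto intro!: indexed_pset.intros simp del: indexed_eval_aux.simps)
  also have "\<dots> = eval_at_variables ?P \<otimes> s \<oplus> eval_at_variables Q"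
    using eval_at_variables_pmult[OF indexed_poly_over_pset[OF K(1) P] B] by simp
  also have "\<dots> = eval (rev (map eval_at_variables Qs)) s \<otimes> s \<oplus> eval_at_variables Q"
    using Cons by simp
  also have "\<dots> = eval (rev (map eval_at_variables Qs) @ [eval_at_variables Q]) s"
    using Cons.prems mono cl B by (intro eval_append_aux[symmetric]) auto
  finally show ?case by simp
qed

end

section \<open>Algebraic independence and finite transcendence degree\<close>

context field
begin

text \<open>A nontrivial relation for \<open>insert s B\<close>, expanded in \<open>s\<close>, has a
  nonzero coefficient in the variables \<open>B\<close>. Independence of \<open>B\<close> keeps its
  value nonzero, so the relation becomes a nonzero polynomial over \<open>K(B)\<close> with root
  \<open>s\<close>.\<close>

lemma algebraic_if_not_independent_insert:
  assumes K: "subfield K R" and B: "B \<subseteq> carrier R" "s \<in> carrier R"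
    and ind: "alg_independent K B" and dep: "\<not> alg_independent K (insert s B)"
  shows "(algebraic over generate_field R (K \<union> B)) s"
proof -
  let ?L = "generate_field R (K \<union> B)"
  have K': "K \<subseteq> carrier R" "\<zero> \<in> K" using subfieldE(3)[OF K] subringE(2)[OF subfieldE(1)[OF K]] by auto
  obtain P where P: "P \<in> indexed_pset (insert s B) K" "eval_at_variables P = \<zero>" "P \<noteq> indexed_const \<zero>"
    using dep unfolding alg_independent_def by blast
  obtain Qs where Qs: "set Qs \<subseteq> indexed_pset B K" "P = indexed_eval_aux Qs s"
    using indexed_pset_insertE[OF K' P(1)] .
  let ?p = "rev (map eval_at_variables Qs)"
  have sub: "?L \<subseteq> carrier R" using generate_field_in_carrier[of "K \<union> B"] K' B by auto
  have p: "set ?p \<subseteq> ?L" using Qs eval_at_variables_in_generate_field[OF K'(1) B(1)] by auto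
  have ev: "eval ?p s = \<zero>"
    using eval_at_variables_indexed_eval_aux[OF K' _ Qs(1), of s] P(2) Qs(2) B by simp
  \<comment> \<open>Normalizing drops leading zeros; an empty result would mean that all
    coefficients vanish at \<open>B\<close>, hence are zero polynomials.\<close>
  have "normalize ?p \<noteq> []"
  proof
    have norm: "normalize q = [] \<Longrightarrow> set q \<subseteq> {\<zero>}" for q
      by (induction q) (auto split: if_splits)
    assume "normalize ?p = []"
    then have "set ?p \<subseteq> {\<zero>}" using norm by blast
    then have "set Qs \<subseteq> {indexed_const \<zero>}"
      using ind Qs(1) unfolding alg_independent_def by auto
    then have "indexed_eval_aux Qs s = indexed_const \<zero>"
      by (induction Qs) (auto simp: indexed_padd_def indexed_zero_def indexed_pmult_def)
    then show False using P Qs by simp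
  qed
  moreover have "polynomial ?L (normalize ?p)"
    using p by (rule normalize_gives_polynomial)
  moreover have "eval (normalize ?p) s = \<zero>"
    using ev eval_normalize[of ?p s] p sub B by auto
  ultimately show ?thesis by (intro algebraicI[of "normalize ?p"]) (unfold univ_poly_carrier[symmetric], assumption+)
qed

text \<open>A maximal independent subset \<open>B\<close> of the generators is a basis: the elements
  algebraic over \<open>K(B)\<close> form a field containing \<open>K\<close> and
  \<open>S\<close>.\<close>

lemma finite_trdeg_if_finitely_generated:
  assumes K: "subfield K R" and S: "finite S" "S \<subseteq> L" "L \<subseteq> generate_field R (K \<union> S)" "L \<subseteq> carrier R"
  shows "finite_trdeg K L"
proof -
  have Kc: "K \<subseteq> carrier R" using subfieldE(3)[OF K] .
  have Sc: "S \<subseteq> carrier R" using S by blast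
  \<comment> \<open>Without variables every polynomial is a constant, so there is at least one
    independent subset to maximize over.\<close>
  have "alg_independent K {}"
  proof -
    have const: "\<exists>k\<in>K. P = indexed_const k" if "P \<in> indexed_pset {} K" for P
      using that
      by induction (auto simp: indexed_padd_const intro: subringE(7)[OF subfieldE(1)[OF K]])
    show ?thesis unfolding alg_independent_def
    proof (intro ballI impI)
      fix P assume P: "P \<in> indexed_pset {} K" "eval_at_variables P = \<zero>"
      with const obtain k where "k \<in> K" "P = indexed_const k" by blast
      with P(2) Kc eval_at_variables_const[of k] show "P = indexed_const \<zero>" by auto
    qed
  qed
  then have ne: "{B. B \<subseteq> S \<and> alg_independent K B} \<noteq> {}" by auto
  have fin: "finite {B. B \<subseteq> S \<and> alg_independent K B}" using S by auto
  obtain B where B: "B \<subseteq> S" "alg_independent K B"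
    and max: "\<And>B'. B' \<subseteq> S \<Longrightarrow> alg_independent K B' \<Longrightarrow> B \<subseteq> B' \<Longrightarrow> B' = B"
    using finite_has_maximal[OF fin ne] by (metis (mono_tags, lifting) mem_Collect_eq)
  let ?F = "generate_field R (K \<union> B)"
  have F: "subfield ?F R" using Kc B Sc by (intro generate_field_is_subfield) auto
  let ?A = "{x \<in> carrier R. (algebraic over ?F) x}"
  have A: "subfield ?A R" using subfield_of_algebraics[OF F] .
  have "(algebraic over ?F) s" if "s \<in> K \<union> B" for s
    using that by (intro algebraic_self subfieldE(1)[OF F]) (rule generate_field.incl)
  moreover have "(algebraic over ?F) s" if "s \<in> S - B" for s
    using that max[of "insert s B"] B Sc by (intro algebraic_if_not_independent_insert[OF K]) auto
  ultimately have "K \<union> S \<subseteq> ?A" using Kc Sc by blast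
  then have "generate_field R (K \<union> S) \<subseteq> ?A"
    using generate_field_min_subfield1[OF _ A] Kc Sc by blast
  then have "\<forall>x\<in>L. (algebraic over ?F) x" using S by blast
  then have "transcendence_basis K L B" using B S unfolding transcendence_basis_def by auto
  moreover have "finite B" using B(1) S(1) by (rule finite_subset)
  ultimately show ?thesis unfolding finite_trdeg_def by blast
qed

end


section \<open>Definable predicates\<close>

primrec rename_tm :: "(nat \<Rightarrow> nat) \<Rightarrow> tm \<Rightarrow> tm" where
  "rename_tm f (Var i) = Var (f i)"
| "rename_tm f Zero = Zero"
| "rename_tm f One = One"
| "rename_tm f (Plus s t) = Plus (rename_tm f s) (rename_tm f t)"
| "rename_tm f (Minus s t) = Minus (rename_tm f s) (rename_tm f t)"
| "rename_tm f (Times s t) = Times (rename_tm f s) (rename_tm f t)"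
| "rename_tm f (Shift t) = Shift (rename_tm f t)"
| "rename_tm f (Deriv t) = Deriv (rename_tm f t)"

primrec rename_fm :: "(nat \<Rightarrow> nat) \<Rightarrow> fm \<Rightarrow> fm" where
  "rename_fm f (Eq s t) = Eq (rename_tm f s) (rename_tm f t)"
| "rename_fm f (Not p) = Not (rename_fm f p)"
| "rename_fm f (And p q) = And (rename_fm f p) (rename_fm f q)"
| "rename_fm f (Exists i p) = Exists (f i) (rename_fm f p)"

lemma tm_val_rename: "tm_val M v (rename_tm f t) = tm_val M (v \<circ> f) t"
  by (induction t) auto

text \<open>Bound variables are renamed along with the free ones; injectivity excludes
  capture.\<close>

lemma sat_rename:
  assumes "inj f" shows "sat M v (rename_fm f p) = sat M (v \<circ> f) p"
proof (induction p arbitrary: v)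
  case (Exists i p)
  have "v(f i := x) \<circ> f = (v \<circ> f)(i := x)" for x
    using assms by (auto simp: inj_eq)
  then show ?case using Exists by (simp only: rename_fm.simps sat.simps)
qed (auto simp: tm_val_rename)

lemma bound_conj:
  assumes "\<exists>N::nat. \<forall>v w. (\<forall>i<N. v i = w i) \<longrightarrow> f v = f w" "\<exists>N. \<forall>v w. (\<forall>i<N. v i = w i) \<longrightarrow> g v = g w"
  obtains N where "\<And>v w. (\<forall>i<N. v i = w i) \<Longrightarrow> f v = f w \<and> g v = g w"
proof -
  obtain m where m: "\<forall>v w. (\<forall>i<m. v i = w i) \<longrightarrow> f v = f w" using assms(1) ..
  obtain k where k: "\<forall>v w. (\<forall>i<k. v i = w i) \<longrightarrow> g v = g w" using assms(2) ..
  show ?thesis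
  proof (rule that[of "max m k"])
    fix v w :: "nat \<Rightarrow> 'a" assume "\<forall>i<max m k. v i = w i"
    then have "\<forall>i<m. v i = w i" "\<forall>i<k. v i = w i" by simp_all
    with m k show "f v = f w \<and> g v = g w" by simp
  qed
qed

lemma tm_val_cong_bound: "\<exists>N. \<forall>v w. (\<forall>i<N. v i = w i) \<longrightarrow> tm_val M v t = tm_val M w t"
proof (induction t)
  case (Var i) show ?case by (intro exI[of _ "Suc i"]) auto
next
  case (Plus s t)
  obtain N where N: "\<And>v w. (\<forall>i<N. v i = w i) \<Longrightarrow>
    tm_val M v s = tm_val M w s \<and> tm_val M v t = tm_val M w t" by (rule bound_conj[OF Plus]) (rule that)
  show ?case by (intro exI[of _ N] allI impI, drule N) simp
next
  case (Minus s t)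
  obtain N where N: "\<And>v w. (\<forall>i<N. v i = w i) \<Longrightarrow>
    tm_val M v s = tm_val M w s \<and> tm_val M v t = tm_val M w t" by (rule bound_conj[OF Minus]) (rule that)
  show ?case by (intro exI[of _ N] allI impI, drule N) simp
next
  case (Times s t)
  obtain N where N: "\<And>v w. (\<forall>i<N. v i = w i) \<Longrightarrow>
    tm_val M v s = tm_val M w s \<and> tm_val M v t = tm_val M w t" by (rule bound_conj[OF Times]) (rule that)
  show ?case by (intro exI[of _ N] allI impI, drule N) simp
next
  case (Shift t)
  then obtain N where "\<forall>v w. (\<forall>i<N. v i = w i) \<longrightarrow> tm_val M v t = tm_val M w t" ..
  then have "(\<forall>i<N. v i = w i) \<longrightarrow> shift M (tm_val M v t) = shift M (tm_val M w t)" for v w by metis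
  then show ?case by (intro exI[of _ N]) simp
next
  case (Deriv t)
  then obtain N where "\<forall>v w. (\<forall>i<N. v i = w i) \<longrightarrow> tm_val M v t = tm_val M w t" ..
  then have "(\<forall>i<N. v i = w i) \<longrightarrow> deriv M (tm_val M v t) = deriv M (tm_val M w t)" for v w by metis
  then show ?case by (intro exI[of _ N]) simp
qed auto

text \<open>A bound on the relevant variables takes the place of the set of free variables. It
  permits cutting an infinite parameter sequence down to a list.\<close>

lemma sat_cong_bound: "\<exists>N. \<forall>v w. (\<forall>i<N. v i = w i) \<longrightarrow> sat M v p = sat M w p"
proof (induction p)
  case (Eq s t)
  obtain N where N: "\<And>v w. (\<forall>i<N. v i = w i) \<Longrightarrow>
    tm_val M v s = tm_val M w s \<and> tm_val M v t = tm_val M w t" by (rule bound_conj[OF tm_val_cong_bound[of M s] tm_val_cong_bound[of M t]]) (rule that)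
  show ?case by (intro exI[of _ N] allI impI, drule N) simp
next
  case (And p q)
  obtain N where N: "\<And>v w. (\<forall>i<N. v i = w i) \<Longrightarrow>
    sat M v p = sat M w p \<and> sat M v q = sat M w q" by (rule bound_conj[OF And]) (rule that)
  show ?case by (intro exI[of _ N] allI impI, drule N) simp
next
  case (Exists i p)
  then obtain m where m: "\<forall>v w. (\<forall>i<m. v i = w i) \<longrightarrow> sat M v p = sat M w p" ..
  have "sat M (v(i := x)) p = sat M (w(i := x)) p" if "\<forall>i<m. v i = w i" for v w x
    using that by (intro m[rule_format]) simp
  then have "(\<forall>i<m. v i = w i) \<longrightarrow> sat M v (Exists i p) = sat M w (Exists i p)" for v w
    unfolding sat.simps by blast
  then show ?case by blast
qed auto

section \<open>Predicates with separate variables and parameters\<close>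

definition interleave :: "(nat \<Rightarrow> 'a) \<Rightarrow> (nat \<Rightarrow> 'a) \<Rightarrow> nat \<Rightarrow> 'a" where
  "interleave v w i = (if even i then v (i div 2) else w (i div 2))"

text \<open>A predicate on assignments is definable over \<open>A\<close> if it is given by a formula whose
  even-numbered variables are the variables of the predicate and whose odd-numbered variables
  take parameters from \<open>A\<close> as values. Keeping the two kinds apart allows parameters to be
  merged without renaming the proper variables.\<close>

definition definable_pred :: "'a dd_ring \<Rightarrow> 'a set \<Rightarrow> ((nat \<Rightarrow> 'a) \<Rightarrow> bool) \<Rightarrow> bool" where
  "definable_pred M A Q \<longleftrightarrow> (\<exists>p w. range w \<subseteq> A \<and> Q = (\<lambda>v. sat M (interleave v w) p))"

definition term_fun :: "'a dd_ring \<Rightarrow> 'a set \<Rightarrow> ((nat \<Rightarrow> 'a) \<Rightarrow> 'a) \<Rightarrow> bool" where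
  "term_fun M A F \<longleftrightarrow> (\<exists>t w. range w \<subseteq> A \<and> F = (\<lambda>v. tm_val M (interleave v w) t))"

text \<open>Parameter slot \<open>2 * k + 1\<close> moves to \<open>4 * k + 1\<close>, the slot of
  parameter \<open>2 * k\<close> in the merged sequence, where \<open>interleave\<close> puts the
  \<open>k\<close>-th entry of the first sequence. For the second sequence \<open>to_second\<close>
  uses slot \<open>4 * k + 3\<close>, that of parameter \<open>2 * k + 1\<close>.\<close>

definition to_first :: "nat \<Rightarrow> nat" where
  "to_first i = (if even i then i else 2 * i - 1)"

definition to_second :: "nat \<Rightarrow> nat" where
  "to_second i = (if even i then i else 2 * i + 1)"

lemma interleave_to_first: "interleave v (interleave w w') \<circ> to_first = interleave v w"
proof
  fix i
  show "(interleave v (interleave w w') \<circ> to_first) i = interleave v w i"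
  proof (cases "even i")
    case False
    then obtain k where "i = 2 * k + 1" by (auto elim: oddE)
    then show ?thesis by (simp add: to_first_def interleave_def)
  qed (simp add: to_first_def interleave_def)
qed

lemma interleave_to_second: "interleave v (interleave w w') \<circ> to_second = interleave v w'"
proof
  fix i
  show "(interleave v (interleave w w') \<circ> to_second) i = interleave v w' i"
  proof (cases "even i")
    case False
    then obtain k where "i = 2 * k + 1" by (auto elim: oddE)
    then show ?thesis by (simp add: to_second_def interleave_def)
  qed (simp add: to_second_def interleave_def)
qed

lemma inj_by_parity:
  assumes "\<And>i. even (f i) = even i" "\<And>i j. f (2 * i) = f (2 * j) \<Longrightarrow> i = j"
    "\<And>i j. f (2 * i + 1) = f (2 * j + 1) \<Longrightarrow> i = j"
  shows "inj (f :: nat \<Rightarrow> nat)"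
proof (rule injI)
  fix i j assume eq: "f i = f j"
  then have par: "even i = even j" using assms(1)[of i] assms(1)[of j] by simp
  show "i = j"
  proof (cases "even i")
    case True
    then have "i = 2 * (i div 2)" "j = 2 * (j div 2)" using par by simp_all
    then show ?thesis using eq assms(2)[of "i div 2" "j div 2"] by simp
  next
    case False
    then have "i = 2 * (i div 2) + 1" "j = 2 * (j div 2) + 1" using par by simp_all
    then show ?thesis using eq assms(3)[of "i div 2" "j div 2"] by simp
  qed
qed

lemma inj_to_first: "inj to_first"
  by (rule inj_by_parity) (auto simp: to_first_def odd_pos)

lemma inj_to_second: "inj to_second"
  by (rule inj_by_parity) (auto simp: to_second_def)

lemma range_interleave: "range w \<subseteq> A \<Longrightarrow> range w' \<subseteq> A \<Longrightarrow> range (interleave w w') \<subseteq> A"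
  by (auto simp: interleave_def)

lemma definable_pred_merge:
  assumes "definable_pred M A P" "definable_pred M A Q"
  shows "\<exists>w p q. range w \<subseteq> A \<and> P = (\<lambda>v. sat M (interleave v w) p) \<and>
    Q = (\<lambda>v. sat M (interleave v w) q)"
proof -
  obtain p w q w' where *: "range w \<subseteq> A" "P = (\<lambda>v. sat M (interleave v w) p)"
    "range w' \<subseteq> A" "Q = (\<lambda>v. sat M (interleave v w') q)"
    using assms unfolding definable_pred_def by blast
  show ?thesis
    by (intro exI[of _ "interleave w w'"] exI[of _ "rename_fm to_first p"] exI[of _ "rename_fm to_second q"])
      (use * range_interleave[OF *(1,3)] in \<open>simp add: sat_rename inj_to_first inj_to_second interleave_to_first interleave_to_second\<close>)
qed

lemma definable_pred_And:
  assumes "definable_pred M A P" "definable_pred M A Q" shows "definable_pred M A (\<lambda>v. P v \<and> Q v)"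
proof -
  obtain p q w where "range w \<subseteq> A" "P = (\<lambda>v. sat M (interleave v w) p)" "Q = (\<lambda>v. sat M (interleave v w) q)"
    using definable_pred_merge[OF assms] by (elim exE conjE) (rule that)
  then show ?thesis unfolding definable_pred_def by (intro exI[of _ "And p q"] exI[of _ w]) auto
qed

lemma definable_pred_Not:
  assumes "definable_pred M A P" shows "definable_pred M A (\<lambda>v. \<not> P v)"
proof -
  obtain p w where "range w \<subseteq> A" "P = (\<lambda>v. sat M (interleave v w) p)"
    using assms unfolding definable_pred_def by blast
  then show ?thesis unfolding definable_pred_def by (intro exI[of _ "Not p"] exI[of _ w]) auto
qed

lemma definable_pred_Exists:
  assumes "definable_pred M A P" shows "definable_pred M A (\<lambda>v. \<exists>x\<in>carrier M. P (v(i := x)))"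
proof -
  obtain p w where *: "range w \<subseteq> A" "P = (\<lambda>v. sat M (interleave v w) p)"
    using assms unfolding definable_pred_def by blast
  have "interleave (v(i := x)) w = (interleave v w)(2 * i := x)" for v x
    by (rule ext) (auto simp: interleave_def)
  then show ?thesis unfolding definable_pred_def using *
    by (intro exI[of _ "Exists (2 * i) p"] exI[of _ w]) auto
qed

lemma definable_pred_rename:
  assumes "definable_pred M A P" "inj f" shows "definable_pred M A (\<lambda>v. P (v \<circ> f))"
proof -
  obtain p w where *: "range w \<subseteq> A" "P = (\<lambda>v. sat M (interleave v w) p)"
    using assms unfolding definable_pred_def by blast
  define g where "g i = (if even i then 2 * f (i div 2) else i)" for i
  have "inj g"
    using \<open>inj f\<close> by (intro inj_by_parity) (auto simp: g_def inj_eq)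
  moreover have "interleave v w \<circ> g = interleave (v \<circ> f) w" for v
    by (rule ext) (auto simp: interleave_def g_def)
  ultimately show ?thesis unfolding definable_pred_def using *
    by (intro exI[of _ "rename_fm g p"] exI[of _ w]) (auto simp: sat_rename)
qed

text \<open>Formulas quantify one variable at a time. The induction splits off the last entry of the
  tuple, whose quantifier becomes the outermost one, at variable \<open>k + n\<close>.\<close>

lemma definable_pred_Exists_tuple:
  assumes "definable_pred M A Q"
  shows "definable_pred M A (\<lambda>v. \<exists>x\<in>tuples M n. Q (\<lambda>i. if k \<le> i \<and> i < k + n then x ! (i - k) else v i))"
proof (induction n)
  case 0
  have "tuples M 0 = {[]}" by (auto simp: tuples_def)
  moreover have "(\<lambda>i. if k \<le> i \<and> i < k + 0 then [] ! (i - k) else v i) = v" for v :: "nat \<Rightarrow> 'a"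
    by (auto simp: fun_eq_iff)
  ultimately show ?case using assms by (simp only: bex_simps simp_thms)
next
  case (Suc n)
  let ?o = "\<lambda>n x v i. if k \<le> i \<and> i < k + n then x ! (i - k) else v i"
  have "(\<exists>x\<in>tuples M (Suc n). Q (?o (Suc n) x v)) \<longleftrightarrow>
      (\<exists>y\<in>carrier M. \<exists>x\<in>tuples M n. Q (?o n x (v(k + n := y))))" for v
  proof -
    have eq: "?o (Suc n) (x @ [y]) v = ?o n x (v(k + n := y))" if "length x = n" for x y
      using that by (auto simp: fun_eq_iff nth_append)
    have "tuples M (Suc n) = {x @ [y] | x y. x \<in> tuples M n \<and> y \<in> carrier M}"
    proof
      show "tuples M (Suc n) \<subseteq> {x @ [y] | x y. x \<in> tuples M n \<and> y \<in> carrier M}"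
      proof
        fix z assume z: "z \<in> tuples M (Suc n)"
        then obtain x y where "z = x @ [y]" by (cases z rule: rev_cases) (auto simp: tuples_def)
        with z show "z \<in> {x @ [y] | x y. x \<in> tuples M n \<and> y \<in> carrier M}" by (auto simp: tuples_def)
      qed
    qed (auto simp: tuples_def)
    then have "(\<exists>x\<in>tuples M (Suc n). P x) \<longleftrightarrow> (\<exists>x\<in>tuples M n. \<exists>y\<in>carrier M. P (x @ [y]))" for P
      by auto
    then have "(\<exists>x\<in>tuples M (Suc n). Q (?o (Suc n) x v)) \<longleftrightarrow>
      (\<exists>x\<in>tuples M n. \<exists>y\<in>carrier M. Q (?o (Suc n) (x @ [y]) v))" .
    also have "\<dots> \<longleftrightarrow> (\<exists>y\<in>carrier M. \<exists>x\<in>tuples M n. Q (?o n x (v(k + n := y))))"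
    proof -
      have "Q (?o (Suc n) (x @ [y]) v) = Q (?o n x (v(k + n := y)))" if "x \<in> tuples M n" for x y
        using that eq by (simp only: tuples_def mem_Collect_eq)
      then show ?thesis by blast
    qed
    finally show ?thesis .
  qed
  then show ?case using definable_pred_Exists[OF Suc, of "k + n"] by (simp only:)
qed

lemma term_fun_merge:
  assumes "term_fun M A F" "term_fun M A G"
  shows "\<exists>w s t. range w \<subseteq> A \<and> F = (\<lambda>v. tm_val M (interleave v w) s) \<and>
    G = (\<lambda>v. tm_val M (interleave v w) t)"
proof -
  obtain s w t w' where *: "range w \<subseteq> A" "F = (\<lambda>v. tm_val M (interleave v w) s)"
    "range w' \<subseteq> A" "G = (\<lambda>v. tm_val M (interleave v w') t)"
    using assms unfolding term_fun_def by blast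
  show ?thesis
    by (intro exI[of _ "interleave w w'"] exI[of _ "rename_tm to_first s"] exI[of _ "rename_tm to_second t"])
      (use * range_interleave[OF *(1,3)] in \<open>simp add: tm_val_rename interleave_to_first interleave_to_second\<close>)
qed

lemma definable_pred_Eq:
  assumes "term_fun M A F" "term_fun M A G" shows "definable_pred M A (\<lambda>v. F v = G v)"
proof -
  obtain s t w where "range w \<subseteq> A" "F = (\<lambda>v. tm_val M (interleave v w) s)" "G = (\<lambda>v. tm_val M (interleave v w) t)"
    using term_fun_merge[OF assms] by (elim exE conjE) (rule that)
  then show ?thesis unfolding definable_pred_def by (intro exI[of _ "Eq s t"] exI[of _ w]) auto
qed

lemma term_fun_Plus:
  assumes "term_fun M A F" "term_fun M A G" shows "term_fun M A (\<lambda>v. F v \<oplus>\<^bsub>M\<^esub> G v)"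
proof -
  obtain s t w where "range w \<subseteq> A" "F = (\<lambda>v. tm_val M (interleave v w) s)" "G = (\<lambda>v. tm_val M (interleave v w) t)"
    using term_fun_merge[OF assms] by (elim exE conjE) (rule that)
  then show ?thesis unfolding term_fun_def by (intro exI[of _ "Plus s t"] exI[of _ w]) auto
qed

lemma term_fun_Times:
  assumes "term_fun M A F" "term_fun M A G" shows "term_fun M A (\<lambda>v. F v \<otimes>\<^bsub>M\<^esub> G v)"
proof -
  obtain s t w where "range w \<subseteq> A" "F = (\<lambda>v. tm_val M (interleave v w) s)" "G = (\<lambda>v. tm_val M (interleave v w) t)"
    using term_fun_merge[OF assms] by (elim exE conjE) (rule that)
  then show ?thesis unfolding term_fun_def by (intro exI[of _ "Times s t"] exI[of _ w]) auto
qed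

text \<open>A parameter sequence is total even if the term has no parameters; \<open>a\<close> fills
  it.\<close>

lemma term_fun_tm:
  assumes "a \<in> A" shows "term_fun M A (\<lambda>v. tm_val M (v \<circ> f) t)"
proof -
  have "interleave v w \<circ> (\<lambda>i. 2 * f i) = v \<circ> f" for v w :: "nat \<Rightarrow> 'a" by (auto simp: interleave_def)
  then show ?thesis unfolding term_fun_def using assms
    by (intro exI[of _ "rename_tm (\<lambda>i. 2 * f i) t"] exI[of _ "\<lambda>_. a"]) (auto simp: tm_val_rename)
qed

lemma term_fun_Var: "a \<in> A \<Longrightarrow> term_fun M A (\<lambda>v. v i)"
  using term_fun_tm[of a A M id "Var i"] by simp

lemma term_fun_Zero: "a \<in> A \<Longrightarrow> term_fun M A (\<lambda>v. \<zero>\<^bsub>M\<^esub>)"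
  using term_fun_tm[of a A M id "Zero"] by simp

lemma term_fun_param: "a \<in> A \<Longrightarrow> term_fun M A (\<lambda>v. a)"
  unfolding term_fun_def by (intro exI[of _ "Var 1"] exI[of _ "\<lambda>_. a"]) (auto simp: interleave_def)

lemma definable_pred_mono: "definable_pred M A P \<Longrightarrow> A \<subseteq> B \<Longrightarrow> definable_pred M B P"
  unfolding definable_pred_def by blast

text \<open>The list \<open>c\<close> is extended to a parameter sequence by zero, the default value
  that \<open>holds\<close> gives to the remaining variables; hence the hypothesis on zero.\<close>

lemma definable_pred_holds:
  assumes "set c \<subseteq> A" "\<zero>\<^bsub>M\<^esub> \<in> A"
  shows "definable_pred M A (\<lambda>v. holds M p (map v [0..<n] @ c))"
proof -
  define f where "f i = (if i < n then 2 * i else 2 * (i - n) + 1)" for i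
  have "inj f"
  proof (rule injI)
    fix i j assume eq: "f i = f j"
    have par: "even (f i) \<longleftrightarrow> i < n" for i by (simp add: f_def)
    then have "i < n \<longleftrightarrow> j < n" using eq by metis
    then show "i = j" using eq by (cases "i < n") (auto simp: f_def)
  qed
  moreover define w where "w i = (if i < length c then c ! i else \<zero>\<^bsub>M\<^esub>)" for i
  have "interleave v w \<circ> f = (\<lambda>i. if i < length (map v [0..<n] @ c) then (map v [0..<n] @ c) ! i else \<zero>\<^bsub>M\<^esub>)" for v
    by (auto simp: fun_eq_iff interleave_def f_def w_def nth_append)
  moreover have "range w \<subseteq> A" using assms by (auto simp: w_def)
  ultimately show ?thesis unfolding definable_pred_def holds_def
    by (intro exI[of _ "rename_fm f p"] exI[of _ w]) (auto simp: sat_rename)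
qed

text \<open>The converse passage: \<open>N\<close> bounds the variables that matter, so the first
  \<open>N\<close> parameters suffice as the list \<open>c\<close>.\<close>

lemma definable_pred_imp_holds:
  assumes "definable_pred M A Q"
  shows "\<exists>p c. set c \<subseteq> A \<and>
    (\<forall>x. length x = n \<longrightarrow> holds M p (x @ c) = Q (\<lambda>i. if i < n then x ! i else \<zero>\<^bsub>M\<^esub>))"
proof -
  obtain p w where *: "range w \<subseteq> A" "Q = (\<lambda>v. sat M (interleave v w) p)"
    using assms unfolding definable_pred_def by blast
  obtain N where N: "\<And>v w. (\<forall>i<N. v i = w i) \<Longrightarrow> sat M v p = sat M w p"
    using sat_cong_bound[of M p] by blast
  \<comment> \<open>The list holds \<open>x\<close> in the positions below \<open>n\<close>,
    followed by \<open>N\<close> parameters. All other slots go beyond its end, where a variable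
    gets the default value 0, as required; the summand \<open>i\<close> keeps \<open>f\<close>
    injective.\<close>
  define f where "f i = (if even i then (if i div 2 < n then i div 2 else N + n + i)
      else (if i div 2 < N then n + i div 2 else N + n + i))" for i
  have "inj f"
  proof (rule injI)
    fix i j assume "f i = f j"
    then have "i div 2 = j div 2 \<and> even i = even j \<or> i = j"
      by (simp add: f_def split: if_splits)
    then show "i = j" by presburger
  qed
  have "holds M (rename_fm f p) (x @ map w [0..<N]) = Q (\<lambda>i. if i < n then x ! i else \<zero>\<^bsub>M\<^esub>)"
    if x: "length x = n" for x
    unfolding holds_def sat_rename[OF \<open>inj f\<close>] *(2)
  proof (rule N, intro allI impI)
    fix i assume i: "i < N"
    then have "i div 2 < N" by linarith
    then show "((\<lambda>i. if i < length (x @ map w [0..<N]) then (x @ map w [0..<N]) ! i else \<zero>\<^bsub>M\<^esub>) \<circ> f) i =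
         interleave (\<lambda>i. if i < n then x ! i else \<zero>\<^bsub>M\<^esub>) w i"
      using x by (auto simp: f_def interleave_def nth_append)
  qed
  then show ?thesis using *(1) by (intro exI[of _ "map w [0..<N]"] exI[of _ "rename_fm f p"]) auto
qed


section \<open>Saturation and forking\<close>

lemma term_fun_mono: "term_fun M A F \<Longrightarrow> A \<subseteq> B \<Longrightarrow> term_fun M B F"
  unfolding term_fun_def by blast

lemma definable_pred_Ball_finite:
  assumes "finite \<Q>" "\<And>Q. Q \<in> \<Q> \<Longrightarrow> definable_pred M A (\<lambda>v. Q (v 0))" "a \<in> A"
  shows "definable_pred M A (\<lambda>v. \<forall>Q\<in>\<Q>. Q (v 0))"
  using assms(1,2)
proof (induction \<Q>)
  case empty
  have "definable_pred M A (\<lambda>v. \<zero>\<^bsub>M\<^esub> = \<zero>\<^bsub>M\<^esub>)"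
    using term_fun_Zero[OF assms(3)] by (intro definable_pred_Eq)
  then show ?case by simp
next
  case (insert Q \<Q>)
  then show ?case using definable_pred_And[of M A "\<lambda>v. Q (v 0)"] by simp
qed

text \<open>Saturation for sets of predicates instead of formulas. A formula with parameters is
  chosen for each predicate, and finite sets of formulas are pulled back along this choice.\<close>

lemma saturated_realizes:
  assumes "saturated M" "small M A" "\<zero>\<^bsub>M\<^esub> \<in> A"
    and def: "\<And>Q. Q \<in> \<Q> \<Longrightarrow> definable_pred M A (\<lambda>v. Q (v 0))"
    and fin: "\<And>\<F>. finite \<F> \<Longrightarrow> \<F> \<subseteq> \<Q> \<Longrightarrow> \<exists>x\<in>carrier M. \<forall>Q\<in>\<F>. Q x"
  shows "\<exists>x\<in>carrier M. \<forall>Q\<in>\<Q>. Q x"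
proof -
  have "\<exists>pc. set (snd pc) \<subseteq> A \<and> (\<forall>x. holds M (fst pc) (x # snd pc) = Q x)" if Q: "Q \<in> \<Q>" for Q
  proof -
    obtain p c where pc: "set c \<subseteq> A"
      "\<forall>x. length x = 1 \<longrightarrow> holds M p (x @ c) = Q ((\<lambda>i. if i < 1 then x ! i else \<zero>\<^bsub>M\<^esub>) 0)"
      using definable_pred_imp_holds[OF def[OF Q], of 1] by (elim exE conjE) (rule that)
    have "holds M p (x # c) = Q x" for x using pc(2)[rule_format, of "[x]"] by simp
    then show ?thesis using pc(1) by (intro exI[of _ "(p, c)"]) simp
  qed
  then obtain pc where pc: "\<And>Q. Q \<in> \<Q> \<Longrightarrow> set (snd (pc Q)) \<subseteq> A"
     "\<And>Q x. Q \<in> \<Q> \<Longrightarrow> holds M (fst (pc Q)) (x # snd (pc Q)) = Q x" by metis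
  have "\<exists>x\<in>carrier M. \<forall>(p, c) \<in> pc ` \<Q>. holds M p (x # c)"
  proof (rule assms(1)[unfolded saturated_def, rule_format, of A "pc ` \<Q>"])
    show "small M A \<and> (\<forall>(p, c)\<in>pc ` \<Q>. set c \<subseteq> A) \<and>
      (\<forall>\<Phi>'. finite \<Phi>' \<and> \<Phi>' \<subseteq> pc ` \<Q> \<longrightarrow> (\<exists>x\<in>carrier M. \<forall>(p, c)\<in>\<Phi>'. holds M p (x # c)))"
    proof (intro conjI allI impI)
      show "\<forall>(p, c)\<in>pc ` \<Q>. set c \<subseteq> A" by (simp add: case_prod_beta pc(1))
      fix \<Phi>' assume "finite \<Phi>' \<and> \<Phi>' \<subseteq> pc ` \<Q>"
      then obtain \<F> where F: "finite \<F>" "\<F> \<subseteq> \<Q>" "\<Phi>' = pc ` \<F>"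
        using finite_subset_image[of \<Phi>' pc \<Q>] by blast
      then obtain x where "x \<in> carrier M" "\<forall>Q\<in>\<F>. Q x" using fin by blast
      then show "\<exists>x\<in>carrier M. \<forall>(p, c)\<in>\<Phi>'. holds M p (x # c)"
        using F pc(2) by (intro bexI[of _ x]) (auto simp: case_prod_beta subset_iff)
    qed (fact assms(2))
  qed
  then obtain x where "x \<in> carrier M" "\<forall>(p, c) \<in> pc ` \<Q>. holds M p (x # c)" by blast
  then show ?thesis using pc(2) by (intro bexI[of _ x]) (auto simp: case_prod_beta)
qed

section \<open>Small sets, monotonicity of forking, and finite ranks\<close>

lemma small_insert:
  assumes "small M A" "infinite (carrier M)" "e \<in> carrier M"
  shows "small M (insert e A)"
proof -
  have "insert e A \<prec> carrier M"
  proof (cases "finite A")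
    case True
    then show ?thesis using assms(2)
      by (meson finite.insertI finite_lesspoll_infinite)
  next
    case False
    then show ?thesis using assms(1) infinite_insert_eqpoll[of A e]
      by (meson eq_lesspoll_trans small_def)
  qed
  then show ?thesis using assms by (auto simp: small_def)
qed

lemma small_Un_finite:
  assumes "finite F" "F \<subseteq> carrier M" "small M A" "infinite (carrier M)"
  shows "small M (F \<union> A)"
  using assms(1,2)
proof (induction F)
  case (insert x F)
  then have "small M (insert x (F \<union> A))" using assms(4) by (intro small_insert) auto
  then show ?case by simp
qed (simp add: assms(3))

text \<open>Equality of types over \<open>B\<close> restricts to \<open>A\<close>, so the same
  sequences witness dividing and the same finite cover witnesses forking.\<close>

lemma formula_forks_mono: "formula_forks M n B p b \<Longrightarrow> A \<subseteq> B \<Longrightarrow> formula_forks M n A p b"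
proof -
  assume *: "formula_forks M n B p b" "A \<subseteq> B"
  have st: "same_type M A s t" if "same_type M B s t" for s t
    using that *(2) unfolding same_type_def tp_def by blast
  have "formula_divides M n A q d" if div: "formula_divides M n B q d" for q d
    using div unfolding formula_divides_def
    by - (erule ex_forward, erule ex_forward, erule conj_forward, simp add: st, assumption)
  then have div: "\<forall>(q, d)\<in>\<Psi>. set d \<subseteq> carrier M \<and> formula_divides M n A q d"
    if "\<forall>(q, d)\<in>\<Psi>. set d \<subseteq> carrier M \<and> formula_divides M n B q d" for \<Psi>
    using that by fast
  obtain \<Psi> where \<Psi>: "finite \<Psi>" "\<forall>(q, d)\<in>\<Psi>. set d \<subseteq> carrier M \<and> formula_divides M n B q d"
    "\<forall>x\<in>tuples M n. holds M p (x @ b) \<longrightarrow> (\<exists>(q, d)\<in>\<Psi>. holds M q (x @ d))"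
    using *(1) unfolding formula_forks_def by (elim exE conjE) (rule that)
  show ?thesis unfolding formula_forks_def
    by (intro exI[of _ \<Psi>] conjI \<Psi>(1,3) div[OF \<Psi>(2)])
qed

text \<open>Only the first step of a chain of forking extensions mentions the base. The lemma serves
  to discard the coefficients that are temporarily added to \<open>E\<close>.\<close>

lemma SU_ge_at_natLeq_anti_mono:
  assumes "SU_ge_at M natLeq k B a" "A \<subseteq> B" shows "SU_ge_at M natLeq k A a"
proof (cases k)
  case 0
  then show ?thesis by (simp add: SU_ge_at_natLeq_0)
next
  case (Suc j)
  then obtain C a' where C: "forking_extension M B a C a'" "SU_ge_at M natLeq j C a'"
    using assms(1) SU_ge_at_natLeq_Suc by metis
  have "forking_extension M A a C a'"
  proof -
    have "same_type M A a a'" using C(1) assms(2) unfolding forking_extension_def same_type_def tp_def by blast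
    moreover obtain p b where "(p, b) \<in> tp M C a'" "formula_forks M (length a) B p b"
      using C(1) unfolding forking_extension_def by auto
    ultimately show ?thesis using C(1) assms(2) formula_forks_mono[of M "length a" B p b A]
      unfolding forking_extension_def by auto
  qed
  then show ?thesis using C(2) Suc SU_ge_at_natLeq_Suc by metis
qed

text \<open>\<open>generic\<close> quantifies over well-orders on \<open>'a set\<close>, so finite
  ordinals have to be copied there. The predecessors of \<open>f j\<close> in the copy are the
  images of those of \<open>j\<close>, and the rank condition sees nothing else.\<close>

lemma SU_ge_at_dir_image_natLeq_on:
  assumes "inj f" "j < k"
  shows "SU_ge_at M (dir_image (natLeq_on k) f) (f j) A a \<longleftrightarrow> SU_ge_at M natLeq j A a"
  using assms(2)
proof (induction j arbitrary: A a rule: less_induct)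
  case (less j)
  have "(\<forall>y. (y, f j) \<in> dir_image (natLeq_on k) f \<longrightarrow> y \<noteq> f j \<longrightarrow> P y) \<longleftrightarrow> (\<forall>i<j. P (f i))" for P
    using less.prems assms(1) unfolding dir_image_def by (auto simp: inj_eq)
  moreover have "(\<forall>y. (y, j) \<in> natLeq \<longrightarrow> y \<noteq> j \<longrightarrow> P y) \<longleftrightarrow> (\<forall>i<j. P i)" for P
    by (auto simp: natLeq_def)
  ultimately show ?case
    unfolding SU_ge_at.simps[of M _ "f j" A a] SU_ge_at.simps[of M _ j A a] using less by simp
qed

text \<open>Rank at least omega means rank at least \<open>k\<close> for every \<open>k\<close>, and
  each \<open>k\<close> is the order type of a well-order on \<open>k\<close> singletons, to which
  genericity applies.\<close>

lemma SU_ge_natLeq_if_generic: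
  fixes M :: "'a dd_ring"
  assumes "generic M E G a" "infinite (UNIV :: 'a set)"
    and "\<And>k. \<exists>b\<in>G. SU_ge_at M natLeq k E b"
  shows "SU_ge M natLeq E a"
  unfolding SU_ge_omega_iff
proof
  fix k
  obtain g :: "nat \<Rightarrow> 'a" where g: "inj g" using assms(2) infinite_countable_subset by blast
  define f where "f i = {g i}" for i
  have f: "inj f" using g by (auto simp: f_def inj_def)
  let ?r = "dir_image (natLeq_on k) f"
  have Field: "Field ?r = f ` {..<k}" by (auto simp: dir_image_Field Field_natLeq_on)
  have "Well_order ?r"
    using f by (intro Well_order_dir_image natLeq_on_Well_order) (auto intro: inj_on_subset)
  have iff: "SU_ge M ?r E b \<longleftrightarrow> SU_ge_at M natLeq k E b" for b
  proof -
    have "SU_ge M ?r E b \<longleftrightarrow> (\<forall>j<k. \<exists>B a'. forking_extension M E b B a' \<and> SU_ge_at M natLeq j B a')"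
    proof -
      have "SU_ge M ?r E b \<longleftrightarrow> (\<forall>j<k. \<exists>B a'. forking_extension M E b B a' \<and> SU_ge_at M ?r (f j) B a')"
        unfolding SU_ge_def Field by blast
      then show ?thesis by (simp add: SU_ge_at_dir_image_natLeq_on[OF f])
    qed
    also have "\<dots> \<longleftrightarrow> SU_ge_at M natLeq k E b"
      by (subst SU_ge_at.simps) (auto simp: natLeq_def)
    finally show ?thesis .
  qed
  obtain b where "b \<in> G" "SU_ge_at M natLeq k E b" using assms(3) by blast
  then show "SU_ge_at M natLeq k E a"
    using assms(1) \<open>Well_order ?r\<close> iff unfolding generic_def by blast
qed

text \<open>For \<open>A\<close> containing zero this is nonmembership in \<open>acl M A\<close>,
  phrased by predicates in the form that \<open>saturated_realizes\<close> takes.\<close>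

definition nonalgebraic :: "'a dd_ring \<Rightarrow> 'a set \<Rightarrow> 'a \<Rightarrow> bool" where
  "nonalgebraic M A e \<longleftrightarrow> e \<in> carrier M \<and>
     (\<forall>Q. definable_pred M A (\<lambda>v. Q (v 0)) \<longrightarrow> Q e \<longrightarrow> infinite {x \<in> carrier M. Q x})"

lemma infinite_not_subset_finite: "infinite A \<Longrightarrow> finite B \<Longrightarrow> \<exists>x. x \<in> A \<and> x \<notin> B"
  by (meson finite_subset subsetI)

text \<open>Compactness: an infinite set is not covered by finitely many finite ones, so lying in
  \<open>Y\<close> and outside every finite definable set is finitely satisfiable.\<close>

lemma nonalgebraic_in_infinite_set:
  assumes "saturated M" "small M A" "\<zero>\<^bsub>M\<^esub> \<in> A" "Y \<subseteq> carrier M" "infinite Y"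
    and "definable_pred M A (\<lambda>v. v 0 \<in> Y)"
  shows "\<exists>e\<in>Y. nonalgebraic M A e"
proof -
  let ?A = "{Q. definable_pred M A (\<lambda>v. Q (v 0)) \<and> finite {x \<in> carrier M. Q x}}"
  have "\<exists>x\<in>carrier M. \<forall>Q\<in>insert (\<lambda>x. x \<in> Y) ((\<lambda>Q x. \<not> Q x) ` ?A). Q x"
  proof (rule saturated_realizes[OF assms(1-3)])
    fix Q assume "Q \<in> insert (\<lambda>x. x \<in> Y) ((\<lambda>Q x. \<not> Q x) ` ?A)"
    then show "definable_pred M A (\<lambda>v. Q (v 0))" using assms(6) by (auto intro: definable_pred_Not)
  next
    fix \<F> assume F: "finite \<F>" "\<F> \<subseteq> insert (\<lambda>x. x \<in> Y) ((\<lambda>Q x. \<not> Q x) ` ?A)"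
    have "\<F> - {\<lambda>x. x \<in> Y} \<subseteq> (\<lambda>Q x. \<not> Q x) ` ?A" "finite (\<F> - {\<lambda>x. x \<in> Y})" using F by auto
    then obtain \<G> where G: "finite \<G>" "\<G> \<subseteq> ?A" "\<F> - {\<lambda>x. x \<in> Y} = (\<lambda>Q x. \<not> Q x) ` \<G>"
      using finite_subset_image[of "\<F> - {\<lambda>x. x \<in> Y}" "\<lambda>Q x. \<not> Q x" ?A] by blast
    have "finite (\<Union>Q\<in>\<G>. {x \<in> carrier M. Q x})" using G by blast
    from infinite_not_subset_finite[OF assms(5) this]
    obtain x where x: "x \<in> Y" "x \<notin> (\<Union>Q\<in>\<G>. {x \<in> carrier M. Q x})"
      by (elim exE conjE) (rule that)
    have "Q x" if "Q \<in> \<F>" for Q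
    proof (cases "Q = (\<lambda>x. x \<in> Y)")
      case False
      then have "Q \<in> (\<lambda>Q x. \<not> Q x) ` \<G>" using that G(3) by blast
      then show ?thesis using x assms(4) by auto
    qed (simp add: x)
    then show "\<exists>x\<in>carrier M. \<forall>Q\<in>\<F>. Q x" using x assms(4) by blast
  qed
  then obtain e where "e \<in> carrier M" "e \<in> Y" "\<forall>Q\<in>?A. \<not> Q e" by auto
  then show ?thesis unfolding nonalgebraic_def by (intro bexI[of _ e]) auto
qed

text \<open>If the type of \<open>e\<close> had only finitely many realizations, they could be added
  as parameters and avoided: finitely many conditions of the type define an infinite set, so
  saturation would yield one more realization.\<close>

lemma infinitely_many_conjugates:
  assumes "saturated M" "small M A" "\<zero>\<^bsub>M\<^esub> \<in> A" "infinite (carrier M)" "nonalgebraic M A e"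
  shows "infinite {x \<in> carrier M. \<forall>Q. definable_pred M A (\<lambda>v. Q (v 0)) \<longrightarrow> Q e \<longrightarrow> Q x}"
    (is "infinite ?R")
proof
  assume fin: "finite ?R"
  have na: "infinite {x \<in> carrier M. Q x}" if "definable_pred M A (\<lambda>v. Q (v 0))" "Q e" for Q
    using that assms(5) by (simp add: nonalgebraic_def)
  let ?P = "{Q. definable_pred M A (\<lambda>v. Q (v 0)) \<and> Q e}"
  have "\<exists>x\<in>carrier M. \<forall>Q\<in>?P \<union> (\<lambda>r x. x \<noteq> r) ` ?R. Q x"
  proof (rule saturated_realizes[of M "?R \<union> A"])
    show "small M (?R \<union> A)" using fin assms by (intro small_Un_finite) auto
    show "\<zero>\<^bsub>M\<^esub> \<in> ?R \<union> A" using assms by auto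
    fix Q assume "Q \<in> ?P \<union> (\<lambda>r x. x \<noteq> r) ` ?R"
    then consider "definable_pred M A (\<lambda>v. Q (v 0))" | r where "r \<in> ?R" "Q = (\<lambda>x. x \<noteq> r)" by auto
    then show "definable_pred M (?R \<union> A) (\<lambda>v. Q (v 0))"
    proof cases
      case 2
      then have "definable_pred M (?R \<union> A) (\<lambda>v. v 0 = r)"
        by (intro definable_pred_Eq term_fun_Var[of r] term_fun_param) auto
      then show ?thesis using 2 definable_pred_Not by simp
    qed (auto intro: definable_pred_mono)
  next
    fix \<F> assume F: "finite \<F>" "\<F> \<subseteq> ?P \<union> (\<lambda>r x. x \<noteq> r) ` ?R"
    have "definable_pred M A (\<lambda>v. \<forall>Q\<in>\<F> \<inter> ?P. Q (v 0))"
      using F assms(3) by (intro definable_pred_Ball_finite[of _ _ _ "\<zero>\<^bsub>M\<^esub>"]) auto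
    then have "infinite {x \<in> carrier M. \<forall>Q\<in>\<F> \<inter> ?P. Q x}"
      by (rule na) auto
    from infinite_not_subset_finite[OF this fin]
    obtain x where x': "x \<in> {x \<in> carrier M. \<forall>Q\<in>\<F> \<inter> ?P. Q x}" "x \<notin> ?R"
      by (elim exE conjE) (rule that)
    have x: "x \<in> carrier M \<and> (\<forall>Q\<in>\<F> \<inter> ?P. Q x)"
      using x'(1) by (rule CollectD)
    note x = x[THEN conjunct1] x[THEN conjunct2]
    have "Q x" if "Q \<in> \<F>" for Q
    proof (cases "Q \<in> ?P")
      case False
      then have "Q \<in> (\<lambda>r x. x \<noteq> r) ` ?R" using that F(2) by blast
      then obtain r where "r \<in> ?R" "Q = (\<lambda>x. x \<noteq> r)" by blast
      moreover have "x \<noteq> r"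
      proof
        assume "x = r"
        then have "x \<in> ?R" using \<open>r \<in> ?R\<close> by (rule ssubst)
        with x'(2) show False by (rule notE)
      qed
      ultimately show ?thesis by simp
    next
      case True
      show ?thesis by (rule bspec[OF x(2) IntI[OF that True]])
    qed
    then show "\<exists>x\<in>carrier M. \<forall>Q\<in>\<F>. Q x" using x(1) by blast
  qed (fact assms(1))
  then obtain x where x: "x \<in> carrier M" "\<forall>Q\<in>?P \<union> (\<lambda>r x. x \<noteq> r) ` ?R. Q x" by blast
  have real: "Q x" if "definable_pred M A (\<lambda>v. Q (v 0))" "Q e" for Q
  proof -
    have "Q \<in> ?P" using that by simp
    from bspec[OF x(2) UnI1[OF this]] show ?thesis .
  qed
  have "x \<in> ?R"
  proof (intro CollectI conjI allI impI)
    fix Q :: "'a \<Rightarrow> bool"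
    assume "definable_pred M A (\<lambda>v. Q (v 0))" "Q e"
    then show "Q x" by (rule real)
  qed (rule x(1))
  from bspec[OF x(2) UnI2[OF imageI[OF this]]] show False by simp
qed

text \<open>The extension is realized by \<open>a\<close> itself, which satisfies
  \<open>T x = T a\<close>. The parameters of this formula are \<open>T a\<close> and a list
  \<open>c\<close> over \<open>A\<close>, so its conjugates over \<open>A\<close> differ only in the
  prescribed value.\<close>

lemma forking_extension_fiber:
  assumes sat: "saturated M" and A: "small M A" "\<zero>\<^bsub>M\<^esub> \<in> A" "infinite (carrier M)"
    and T: "term_fun M A (\<lambda>v. T (map v [0..<n]))" and a: "a \<in> tuples M n" "nonalgebraic M A (T a)"
  shows "forking_extension M A a (insert (T a) A) a"
proof -
  let ?e = "T a"
  have e: "?e \<in> carrier M" using a(2) by (auto simp: nonalgebraic_def)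
  let ?R = "{x \<in> carrier M. \<forall>Q. definable_pred M A (\<lambda>v. Q (v 0)) \<longrightarrow> Q ?e \<longrightarrow> Q x}"
  have "infinite ?R" using infinitely_many_conjugates[OF sat A a(2)] .
  then obtain r :: "nat \<Rightarrow> 'a" where r: "inj r" "range r \<subseteq> ?R"
    using infinite_countable_subset by blast
  \<comment> \<open>Variables below \<open>n\<close> carry the point, variable \<open>n\<close> the
    value.\<close>
  have def: "definable_pred M A (\<lambda>v. T (map v [0..<n]) = v n)"
    using T A(2) by (intro definable_pred_Eq term_fun_Var)
  obtain p c where c: "set c \<subseteq> A" and p: "\<forall>x. length x = Suc n \<longrightarrow>
    holds M p (x @ c) = (T (map (\<lambda>i. if i < Suc n then x ! i else \<zero>\<^bsub>M\<^esub>) [0..<n])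
      = (if n < Suc n then x ! n else \<zero>\<^bsub>M\<^esub>))"
    using definable_pred_imp_holds[OF def, of "Suc n"] by (elim exE conjE) (rule that)
  have p: "holds M p (x @ y # c) \<longleftrightarrow> T x = y" if "length x = n" for x y
  proof -
    have "map (\<lambda>i. if i < Suc n then (x @ [y]) ! i else \<zero>\<^bsub>M\<^esub>) [0..<n] = x"
      using that by (intro nth_equalityI) (auto simp: nth_append)
    then show ?thesis using p[rule_format, of "x @ [y]"] that by (simp add: nth_append)
  qed
  have len: "length a = n" using a(1) by (simp add: tuples_def)
  have st: "same_type M A (r i # c) (?e # c)" for i
  proof -
    have "holds M q ((r i # c) @ d) \<longleftrightarrow> holds M q ((?e # c) @ d)" if d: "set d \<subseteq> A" for q d
    proof -
      let ?Q = "\<lambda>x. holds M q (x # c @ d)"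
      have Q: "definable_pred M A (\<lambda>v. ?Q (v 0))"
        using definable_pred_holds[of "c @ d" A M q 1] c d A(2) by simp
      have "r i \<in> ?R" using r by blast
      note transfer = this[THEN CollectD, THEN conjunct2, rule_format]
      \<comment> \<open>Membership in \<open>?R\<close> transfers predicates in one direction only;
        the negation gives the other.\<close>
      show ?thesis using transfer[OF Q] transfer[of "\<lambda>x. \<not> ?Q x", OF definable_pred_Not[OF Q]] by auto
    qed
    then show ?thesis unfolding same_type_def tp_def by auto
  qed
  have "formula_divides M n A p (?e # c)"
    unfolding formula_divides_def
  proof (intro exI conjI allI impI)
    fix i
    show "set (r i # c) \<subseteq> carrier M" using r c A(1) by (auto simp: small_def)
    show "same_type M A (r i # c) (?e # c)" by (rule st)
  next
    fix I :: "nat set" assume "finite I \<and> card I = 2"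
    then obtain i j where ij: "i \<in> I" "j \<in> I" "i \<noteq> j" by (metis card_2_iff')
    show "\<not> (\<exists>x\<in>tuples M n. \<forall>i\<in>I. holds M p (x @ r i # c))"
    proof
      assume "\<exists>x\<in>tuples M n. \<forall>i\<in>I. holds M p (x @ r i # c)"
      then obtain x where "length x = n" "holds M p (x @ r i # c)" "holds M p (x @ r j # c)"
        using ij by (auto simp: tuples_def)
      then show False using p r(1) ij(3) by (metis injD)
    qed
  qed
  then have "formula_forks M (length a) A p (?e # c)"
    using e c A(1) len unfolding formula_forks_def
    by (intro exI[of _ "{(p, ?e # c)}"]) (auto simp: small_def)
  moreover have "(p, ?e # c) \<in> tp M (insert ?e A) a"
    using p len c by (auto simp: tp_def)
  ultimately show ?thesis
    using a(1) small_insert[OF A(1,3) e] unfolding forking_extension_def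
    by (auto simp: tuples_def same_type_def)
qed


section \<open>Rank from functionals in triangular position\<close>

lemma definable_pred_Exists_block:
  assumes "definable_pred M A (\<lambda>v. Q (map v [k..<k + n]) v)"
  shows "definable_pred M A
    (\<lambda>v. \<exists>x\<in>tuples M n. Q x (\<lambda>i. if k \<le> i \<and> i < k + n then x ! (i - k) else v i))"
proof -
  have "map (\<lambda>i. if k \<le> i \<and> i < k + n then x ! (i - k) else v i) [k..<k + n] = x"
    if "x \<in> tuples M n" for x and v :: "nat \<Rightarrow> 'a"
    using that by (intro nth_equalityI) (auto simp: tuples_def)
  then show ?thesis
    using definable_pred_Exists_tuple[OF assms, of n k] by (simp only: cong: bex_cong)
qed

lemma term_fun_Shift: "term_fun M A F \<Longrightarrow> term_fun M A (\<lambda>v. shift M (F v))"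
  unfolding term_fun_def by (metis tm_val.simps(7))

lemma term_fun_Deriv: "term_fun M A F \<Longrightarrow> term_fun M A (\<lambda>v. deriv M (F v))"
  unfolding term_fun_def by (metis tm_val.simps(8))

lemma term_fun_One: "a \<in> A \<Longrightarrow> term_fun M A (\<lambda>v. \<one>\<^bsub>M\<^esub>)"
  using term_fun_tm[of a A M id "One"] by simp

section \<open>Homogeneous linear systems\<close>

lemma (in field) combine_diff:
  assumes "length us = length as" "length as = length bs"
    "set us \<subseteq> carrier R" "set as \<subseteq> carrier R" "set bs \<subseteq> carrier R" "k \<in> carrier R"
  shows "combine us (map2 (\<lambda>a b. a \<ominus> k \<otimes> b) as bs) = combine us as \<ominus> k \<otimes> combine us bs"
  using assms
proof (induction us as bs rule: list_induct3)
  case Nil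
  then show ?case by (simp add: r_neg minus_eq)
next
  case (Cons u us a as b bs)
  have *: "combine us as \<in> carrier R" "combine us bs \<in> carrier R" using Cons.prems by auto
  have "u \<otimes> (a \<ominus> k \<otimes> b) \<oplus> (combine us as \<ominus> k \<otimes> combine us bs) =
      u \<otimes> a \<oplus> combine us as \<ominus> k \<otimes> (u \<otimes> b \<oplus> combine us bs)"
    using * Cons.prems by (simp, algebra)
  then show ?case using Cons by simp
qed

text \<open>Gaussian elimination by induction on the number of unknowns. A step uses up one
  equation, the pivot row, and one unknown, so the equations stay fewer than the unknowns.\<close>

lemma (in field) underdetermined_system:
  assumes "\<And>r. r \<in> set rs \<Longrightarrow> length r = m \<and> set r \<subseteq> carrier R" "length rs < m"
  shows "\<exists>us. length us = m \<and> set us \<subseteq> carrier R \<and> \<not> set us \<subseteq> {\<zero>} \<and> (\<forall>r\<in>set rs. combine us r = \<zero>)"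
  using assms
proof (induction m arbitrary: rs)
  case (Suc m)
  show ?case
  proof (cases "\<exists>r\<in>set rs. hd r \<noteq> \<zero>")
    case False
    have "combine (\<one> # replicate m \<zero>) r = \<zero>" if "r \<in> set rs" for r
    proof -
      from Suc.prems(1)[OF that] obtain a r' where r: "r = a # r'" "length r' = m" "set r' \<subseteq> carrier R"
        by (cases r) auto
      with False that have "a = \<zero>" by force
      then show ?thesis using r combine_replicate[of r'] by simp
    qed
    then show ?thesis by (intro exI[of _ "\<one> # replicate m \<zero>"]) auto
  next
    case True
    then obtain r0 where r0: "r0 \<in> set rs" "hd r0 \<noteq> \<zero>" by blast
    then obtain as bs where split: "rs = as @ r0 # bs" by (meson split_list)
    obtain p r' where r': "r0 = p # r'" "length r' = m" "set r' \<subseteq> carrier R" "p \<in> carrier R" "p \<noteq> \<zero>"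
      using Suc.prems(1)[OF r0(1)] r0(2) by (cases r0) auto
    define g where "g s = map2 (\<lambda>a b. a \<ominus> (hd s \<otimes> inv p) \<otimes> b) (tl s) r'" for s
    have ip: "inv p \<in> carrier R" "inv p \<otimes> p = \<one>" using r' by (auto simp: field_Units)
    have s: "hd s \<in> carrier R" "length (tl s) = m" "set (tl s) \<subseteq> carrier R" "s = hd s # tl s" if "s \<in> set (as @ bs)" for s
    proof -
      have "length s = Suc m" "set s \<subseteq> carrier R" using Suc.prems(1)[of s] that split by auto
      then show "hd s \<in> carrier R" "length (tl s) = m" "set (tl s) \<subseteq> carrier R" "s = hd s # tl s"
        by (cases s; auto)+
    qed
    have g: "length (g s) = m \<and> set (g s) \<subseteq> carrier R" if "s \<in> set (as @ bs)" for s
      using s[OF that] r' ip by (auto simp: g_def set_zip subset_iff)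
    have "\<exists>us. length us = m \<and> set us \<subseteq> carrier R \<and> \<not> set us \<subseteq> {\<zero>} \<and>
       (\<forall>r\<in>set (map g (as @ bs)). combine us r = \<zero>)"
      using g Suc.prems(2) split by (intro Suc.IH) auto
    then obtain us where us: "length us = m" "set us \<subseteq> carrier R" "\<not> set us \<subseteq> {\<zero>}"
      and us0: "\<forall>r\<in>set (map g (as @ bs)). combine us r = \<zero>" by (elim exE conjE) (rule that)
    define c where "c = combine us r'"
    have c: "c \<in> carrier R" using us r' by (auto simp: c_def)
    \<comment> \<open>The pivot row determines the first unknown; the reduced solution
      \<open>us\<close> is already nontrivial.\<close>
    define u where "u = \<ominus> (inv p \<otimes> c)"
    have u: "u \<in> carrier R" using c ip by (simp add: u_def)
    have "combine (u # us) r = \<zero>" if "r \<in> set rs" for r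
    proof (cases "r = r0")
      case True
      have "u \<otimes> p = \<ominus> ((inv p \<otimes> p) \<otimes> c)" using c ip(1) r' unfolding u_def by algebra
      then have "u \<otimes> p \<oplus> c = \<zero>" using c ip by (simp add: l_neg)
      then show ?thesis using True r' by (simp add: c_def)
    next
      case False
      then have r: "r \<in> set (as @ bs)" using that split by auto
      note s = s[OF r]
      have cr: "combine us (tl r) \<in> carrier R" using us s by auto
      have "combine us (g r) = combine us (tl r) \<ominus> (hd r \<otimes> inv p) \<otimes> c"
        unfolding g_def c_def using us s r' ip by (intro combine_diff) auto
      then have "combine us (tl r) \<ominus> (hd r \<otimes> inv p) \<otimes> c = \<zero>" using us0[rule_format, of "g r"] r by auto
      then have "combine us (tl r) = (hd r \<otimes> inv p) \<otimes> c" using cr c ip s by (simp add: r_right_minus_eq)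
      moreover have "u \<otimes> hd r \<oplus> (hd r \<otimes> inv p) \<otimes> c = \<zero>"
        using c ip(1) s(1) unfolding u_def by algebra
      moreover have "combine (u # us) (hd r # tl r) = u \<otimes> hd r \<oplus> combine us (tl r)" by simp
      ultimately show ?thesis using s(4) by metis
    qed
    then show ?thesis using us u by (intro exI[of _ "u # us"]) auto
  qed
qed simp

section \<open>Additive functionals and finite ranks\<close>

context dd_field
begin

definition tuple_add :: "'a list \<Rightarrow> 'a list \<Rightarrow> 'a list" where
  "tuple_add x y = map2 (\<lambda>x y. x \<oplus> y) x y"

lemma tuple_add_closed: "x \<in> tuples M n \<Longrightarrow> y \<in> tuples M n \<Longrightarrow> tuple_add x y \<in> tuples M n"
  by (auto simp: tuple_add_def tuples_def set_zip subset_iff)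

lemma shift_closed: "x \<in> carrier M \<Longrightarrow> shift M x \<in> carrier M"
  and shift_add: "x \<in> carrier M \<Longrightarrow> y \<in> carrier M \<Longrightarrow> shift M (x \<oplus> y) = shift M x \<oplus> shift M y"
  and shift_mult: "x \<in> carrier M \<Longrightarrow> y \<in> carrier M \<Longrightarrow> shift M (x \<otimes> y) = shift M x \<otimes> shift M y"
  and shift_one: "shift M \<one> = \<one>"
  and inj_on_shift: "inj_on (shift M) (carrier M)"
  and shift_image: "shift M ` carrier M = carrier M"
  using shift_iso ring_iso_memE[OF shift_iso] by (auto simp: bij_betw_def)

lemma zero_if_idempotent: "z \<in> carrier M \<Longrightarrow> z = z \<oplus> z \<Longrightarrow> z = \<zero>"
  using add.l_cancel[of z z \<zero>] by simp

lemma shift_zero: "shift M \<zero> = \<zero>"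
  by (rule zero_if_idempotent) (simp_all add: shift_closed shift_add[symmetric])

lemma deriv_zero: "deriv M \<zero> = \<zero>"
  by (rule zero_if_idempotent) (simp_all add: deriv_closed deriv_add[symmetric])

text \<open>A multiple of \<open>c\<close> is a multiple of 1 times \<open>c\<close>, so
  characteristic 0 makes the terms of the progression distinct.\<close>

lemma infinite_if_additive:
  assumes "f (0::nat) \<in> carrier M" "c \<in> carrier M" "c \<noteq> \<zero>" "\<And>m. f (Suc m) = f m \<oplus> c"
  shows "infinite (range f)"
proof -
  have f: "f m = f 0 \<oplus> add_pow M m c" for m
    using assms by (induction m) (auto simp: a_assoc)
  have "inj f"
  proof (rule linorder_injI)
    fix i j :: nat assume ij: "i < j"
    have "add_pow M (j - i) c \<noteq> \<zero>"
    proof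
      assume "add_pow M (j - i) c = \<zero>"
      then have "(add_pow M (j - i) \<one>) \<otimes> c = \<zero>" using assms(2) by (simp add: add_pow_ldistr)
      then show False using char_zero[of "j - i"] ij assms(2,3) by (auto simp: integral_iff)
    qed
    moreover have "f j = f i \<oplus> add_pow M (j - i) c"
    proof -
      have "add_pow M j c = add_pow M i c \<oplus> add_pow M (j - i) c"
        using add.nat_pow_mult[of c i "j - i"] assms(2) ij by simp
      then show ?thesis using f[of i] f[of j] assms(1,2) by (simp add: a_assoc)
    qed
    moreover have "f i \<in> carrier M" using f[of i] assms by simp
    ultimately show "f i \<noteq> f j"
      using assms(2) add.l_cancel[of "f i" "add_pow M (j - i) c" \<zero>] by auto
  qed
  then show ?thesis by (rule range_inj_infinite)
qed

lemma infinite_carrier: "infinite (carrier M)"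
proof -
  have "infinite (range (\<lambda>m::nat. add_pow M m \<one>))"
    using one_not_zero by (intro infinite_if_additive[of _ \<one>]) auto
  moreover have "range (\<lambda>m::nat. add_pow M m \<one>) \<subseteq> carrier M" by auto
  ultimately show ?thesis using finite_subset by blast
qed

text \<open>Linearity is not demanded: shift and derivation do not in general commute with
  scalars.\<close>

definition additive_functional :: "nat \<Rightarrow> ('a list \<Rightarrow> 'a) \<Rightarrow> bool" where
  "additive_functional n T \<longleftrightarrow> (\<forall>x\<in>tuples M n. T x \<in> carrier M \<and> (\<forall>y\<in>tuples M n. T (tuple_add x y) = T x \<oplus> T y))"

text \<open>The head is the first constraint to be imposed. Translation by the point of a later
  entry does not disturb it, so the later functionals can still vary on its fibers.\<close>

primrec triangular :: "(('a list \<Rightarrow> 'a) \<times> 'a list) list \<Rightarrow> bool" where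
  "triangular [] = True"
| "triangular (Ty # Ts) = (fst Ty (snd Ty) \<noteq> \<zero> \<and> (\<forall>Sz\<in>set Ts. fst Ty (snd Sz) = \<zero>) \<and> triangular Ts)"

text \<open>The induction speaks of a set \<open>P\<close> stable under translation by the points,
  not of a subgroup: a fiber \<open>T x = e\<close> with nonzero \<open>e\<close> is no subgroup,
  but keeps this stability. The base grows by \<open>e\<close> in each step, while the realizing
  point stays the same.\<close>

lemma SU_ge_at_of_triangular:
  assumes sat: "saturated M"
    and "small M A" "\<zero> \<in> A"
    and "\<And>T y. (T, y) \<in> set Ts \<Longrightarrow> term_fun M A (\<lambda>v. T (map v [0..<n])) \<and> additive_functional n T \<and> y \<in> tuples M n"
    and "definable_pred M A (\<lambda>v. P (map v [0..<n]))"
    and "x0 \<in> tuples M n" "P x0"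
    and "\<And>T y x. (T, y) \<in> set Ts \<Longrightarrow> x \<in> tuples M n \<Longrightarrow> P x \<Longrightarrow> P (tuple_add x y)"
    and "triangular Ts"
  shows "\<exists>a\<in>tuples M n. P a \<and> SU_ge_at M natLeq (length Ts) A a"
  using assms(2-)
proof (induction Ts arbitrary: A P x0)
  case Nil
  have "SU_ge_at M natLeq (length []) A x0" by (simp add: SU_ge_at_natLeq_0)
  then show ?case using Nil.prems(5,6) by blast
next
  case (Cons Ty Ts)
  obtain T y where Ty: "Ty = (T, y)" by fastforce
  have T: "term_fun M A (\<lambda>v. T (map v [0..<n]))" "additive_functional n T" and y: "y \<in> tuples M n"
    using Cons.prems(3)[of T y] Ty by auto
  define V where "V = {T x | x. x \<in> tuples M n \<and> P x}"
  have Vc: "V \<subseteq> carrier M" using T(2) by (auto simp: V_def additive_functional_def)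
  \<comment> \<open>Each translation by \<open>y\<close> stays in \<open>P\<close> and changes the
    value of \<open>T\<close> by the nonzero amount \<open>T y\<close>.\<close>
  define xs where "xs m = ((\<lambda>x. tuple_add x y) ^^ m) x0" for m
  have step: "P (tuple_add x y)" if "x \<in> tuples M n" "P x" for x
    using Cons.prems(7)[of T y x] that Ty by simp
  have xs: "xs m \<in> tuples M n \<and> P (xs m)" for m
    using Cons.prems(5,6) y step by (induction m) (simp_all add: xs_def tuple_add_closed)
  have "infinite (range (\<lambda>m. T (xs m)))"
  proof (rule infinite_if_additive)
    show "T (xs 0) \<in> carrier M" "T y \<in> carrier M" using T(2) xs y by (auto simp: additive_functional_def)
    show "T y \<noteq> \<zero>" using Cons.prems(8) Ty by simp
    show "T (xs (Suc m)) = T (xs m) \<oplus> T y" for m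
      using T(2) xs[of m] y by (simp add: xs_def additive_functional_def)
  qed
  moreover have "range (\<lambda>m. T (xs m)) \<subseteq> V" using xs by (auto simp: V_def)
  ultimately have Vinf: "infinite V" using finite_subset by blast
  have Vdef: "definable_pred M A (\<lambda>v. v 0 \<in> V)"
  proof -
    have "definable_pred M A (\<lambda>v. P (map v [0..<n]) \<and> T (map v [0..<n]) = v n)"
      by (rule definable_pred_And[OF Cons.prems(4) definable_pred_Eq[OF T(1) term_fun_Var[OF Cons.prems(2)]]])
    from definable_pred_Exists_block[of M A "\<lambda>x v. P x \<and> T x = v n" 0 n, simplified, OF this]
    have "definable_pred M A (\<lambda>v. \<exists>x\<in>tuples M n. P x \<and> T x = v n)" .
    \<comment> \<open>The free variable \<open>n\<close> is renamed to 0, the place that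
      \<open>nonalgebraic_in_infinite_set\<close> expects; the successor makes room for it.\<close>
    moreover have "inj (\<lambda>i. if i = n then 0 else Suc i)" by (auto simp: inj_def)
    ultimately have "definable_pred M A (\<lambda>v. \<exists>x\<in>tuples M n. P x \<and>
        T x = (v \<circ> (\<lambda>i. if i = n then 0 else Suc i)) n)"
      by (rule definable_pred_rename)
    moreover have "(v \<circ> (\<lambda>i. if i = n then 0 else Suc i)) n = v 0" for v :: "nat \<Rightarrow> 'a" by simp
    moreover have "(\<exists>x\<in>tuples M n. P x \<and> T x = z) \<longleftrightarrow> z \<in> V" for z by (auto simp: V_def)
    ultimately show ?thesis by (simp only:)
  qed
  obtain e where e: "e \<in> V" "nonalgebraic M A e"
    using nonalgebraic_in_infinite_set[OF sat Cons.prems(1,2) Vc Vinf Vdef] by blast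
  then obtain x1 where x1: "x1 \<in> tuples M n" "P x1" "T x1 = e" by (auto simp: V_def)
  have ec: "e \<in> carrier M" using e Vc by auto
  have sub: "A \<subseteq> insert e A" by auto
  have "\<exists>a\<in>tuples M n. (P a \<and> T a = e) \<and> SU_ge_at M natLeq (length Ts) (insert e A) a"
  proof (rule Cons.IH[of "insert e A" "\<lambda>a. P a \<and> T a = e" x1])
    show "small M (insert e A)" by (rule small_insert[OF Cons.prems(1) infinite_carrier ec])
    show "\<zero> \<in> insert e A" using Cons.prems by auto
    show "definable_pred M (insert e A) (\<lambda>v. P (map v [0..<n]) \<and> T (map v [0..<n]) = e)"
      by (rule definable_pred_And[OF definable_pred_mono[OF Cons.prems(4) sub]
        definable_pred_Eq[OF term_fun_mono[OF T(1) sub] term_fun_param]]) simp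
    show "x1 \<in> tuples M n" "P x1 \<and> T x1 = e" using x1 by auto
    show "triangular Ts" using Cons.prems by simp
  next
    fix T' y' assume "(T', y') \<in> set Ts"
    then show "term_fun M (insert e A) (\<lambda>v. T' (map v [0..<n])) \<and> additive_functional n T' \<and> y' \<in> tuples M n"
      using Cons.prems(3)[of T' y'] term_fun_mono[OF _ sub] by auto
  next
    fix T' y' x assume *: "(T', y') \<in> set Ts" "x \<in> tuples M n" "P x \<and> T x = e"
    then have "T y' = \<zero>" "y' \<in> tuples M n" using Cons.prems(8) Cons.prems(3)[of T' y'] Ty by force+
    then show "P (tuple_add x y') \<and> T (tuple_add x y') = e"
      using * Cons.prems(7)[of T' y' x] T(2) ec unfolding additive_functional_def by auto
  qed
  then obtain a where a: "a \<in> tuples M n" "P a" "T a = e" "SU_ge_at M natLeq (length Ts) (insert e A) a" by blast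
  have "forking_extension M A a (insert e A) a"
    using forking_extension_fiber[OF sat Cons.prems(1,2) infinite_carrier T(1) a(1)] a(3) e(2) by simp
  then have "SU_ge_at M natLeq (Suc (length Ts)) A a" using a(4) SU_ge_at_natLeq_Suc by blast
  then show ?case using a by auto
qed

end


section \<open>Functionals given by monomials\<close>

inductive monomial_tm :: "nat \<Rightarrow> tm \<Rightarrow> bool" for n where
  Var: "l < n \<Longrightarrow> monomial_tm n (Var l)"
| Shift: "monomial_tm n t \<Longrightarrow> monomial_tm n (Shift t)"
| Deriv: "monomial_tm n t \<Longrightarrow> monomial_tm n (Deriv t)"

context dd_field
begin

text \<open>Entries of \<open>x\<close> beyond its length are unspecified, but a monomial on
  \<open>n\<close> coordinates reads only one of the first \<open>n\<close>.\<close>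

definition tm_at :: "tm \<Rightarrow> 'a list \<Rightarrow> 'a" where
  "tm_at t x = tm_val M (\<lambda>i. x ! i) t"

definition lin :: "'a list \<Rightarrow> tm list \<Rightarrow> 'a list \<Rightarrow> 'a" where
  "lin us ts x = combine us (map (\<lambda>t. tm_at t x) ts)"

lemma tm_at_Shift: "tm_at (Shift t) x = shift M (tm_at t x)"
  and tm_at_Deriv: "tm_at (Deriv t) x = deriv M (tm_at t x)"
  by (simp_all add: tm_at_def)

lemma tm_at_map: "monomial_tm n t \<Longrightarrow> tm_at t (map v [0..<n]) = tm_val M v t"
  by (induction rule: monomial_tm.induct) (auto simp: tm_at_def)

lemma additive_functional_tm_at:
  assumes "monomial_tm n t" shows "additive_functional n (tm_at t)"
  using assms
proof induction
  case (Var l)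
  then show ?case
    by (auto simp: additive_functional_def tm_at_def tuple_add_def tuples_def)
next
  case (Shift t)
  then show ?case
    by (simp add: additive_functional_def tm_at_Shift shift_closed shift_add)
next
  case (Deriv t)
  then show ?case
    by (simp add: additive_functional_def tm_at_Deriv deriv_closed deriv_add)
qed

lemma tm_at_closed: "monomial_tm n t \<Longrightarrow> x \<in> tuples M n \<Longrightarrow> tm_at t x \<in> carrier M"
  using additive_functional_tm_at by (simp add: additive_functional_def)

lemma lin_Cons: "lin (u # us) (t # ts) x = u \<otimes> tm_at t x \<oplus> lin us ts x"
  by (simp add: lin_def)

lemma lin_closed:
  assumes "set us \<subseteq> carrier M" "\<forall>t\<in>set ts. monomial_tm n t" "x \<in> tuples M n"
  shows "lin us ts x \<in> carrier M"
  using assms unfolding lin_def by (intro combine_in_carrier) (auto intro: tm_at_closed)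

lemma additive_functional_lin:
  assumes "length us = length ts" "set us \<subseteq> carrier M" "\<forall>t\<in>set ts. monomial_tm n t"
  shows "additive_functional n (lin us ts)"
  using assms
proof (induction us ts rule: list_induct2)
  case Nil
  then show ?case by (simp add: additive_functional_def lin_def)
next
  case (Cons u us t ts)
  have t: "additive_functional n (tm_at t)" using Cons.prems by (intro additive_functional_tm_at) simp
  have IH: "additive_functional n (lin us ts)" using Cons by simp
  have u: "u \<in> carrier M" using Cons.prems by simp
  show ?case unfolding additive_functional_def lin_Cons
  proof (intro ballI conjI)
    fix x y assume x: "x \<in> tuples M n" and y: "y \<in> tuples M n"
    have c: "tm_at t x \<in> carrier M" "tm_at t y \<in> carrier M" "lin us ts x \<in> carrier M" "lin us ts y \<in> carrier M"
      using t IH x y by (auto simp: additive_functional_def)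
    have "tm_at t (tuple_add x y) = tm_at t x \<oplus> tm_at t y" "lin us ts (tuple_add x y) = lin us ts x \<oplus> lin us ts y"
      using t IH x y by (auto simp: additive_functional_def)
    then show "u \<otimes> tm_at t (tuple_add x y) \<oplus> lin us ts (tuple_add x y)
      = u \<otimes> tm_at t x \<oplus> lin us ts x \<oplus> (u \<otimes> tm_at t y \<oplus> lin us ts y)"
      using c u by (simp add: r_distr a_ac)
  next
    fix x assume x: "x \<in> tuples M n"
    then show "u \<otimes> tm_at t x \<oplus> lin us ts x \<in> carrier M"
      using t IH u by (simp add: additive_functional_def)
  qed
qed

text \<open>The coefficients are term functions too, because in \<open>coefficients_in_acl\<close>
  they are variables to be quantified and not parameters.\<close>

lemma term_fun_combine:
  assumes "length Fs = length Hs" "a \<in> A"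
    "\<forall>F\<in>set Fs. term_fun M A F" "\<forall>H\<in>set Hs. term_fun M A H"
  shows "term_fun M A (\<lambda>v. combine (map (\<lambda>F. F v) Fs) (map (\<lambda>H. H v) Hs))"
  using assms
proof (induction Fs Hs rule: list_induct2)
  case Nil
  then show ?case using term_fun_Zero[of a A M] by simp
next
  case (Cons F Fs H Hs)
  have "term_fun M A (\<lambda>v. F v \<otimes> H v \<oplus> combine (map (\<lambda>F. F v) Fs) (map (\<lambda>H. H v) Hs))"
    using Cons by (intro term_fun_Plus term_fun_Times) auto
  then show ?case by simp
qed

lemma term_fun_lin:
  assumes "length us = length ts" "a \<in> A" "set us \<subseteq> A" "\<forall>t\<in>set ts. monomial_tm n t"
  shows "term_fun M A (\<lambda>v. lin us ts (map v [0..<n]))"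
proof -
  have "term_fun M A (\<lambda>v. combine (map (\<lambda>F. F v) (map (\<lambda>u v. u) us))
     (map (\<lambda>H. H v) (map (\<lambda>t v. tm_val M v t) ts)))"
  proof (intro term_fun_combine ballI)
    show "term_fun M A F" if "F \<in> set (map (\<lambda>u v. u) us)" for F
      using that assms(3) by (auto intro: term_fun_param)
    show "term_fun M A H" if "H \<in> set (map (\<lambda>t v. tm_val M v t) ts)" for H
      using that term_fun_tm[OF assms(2), of M id] by auto
  qed (use assms in auto)
  moreover have "map (\<lambda>t. tm_at t (map v [0..<n])) ts = map (\<lambda>t. tm_val M v t) ts" for v
    using assms(4) by (simp add: tm_at_map)
  ultimately show ?thesis by (simp add: lin_def comp_def cong: map_cong)
qed

text \<open>Lists are used since distinct words may coincide on \<open>G\<close>; such a repetition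
  is a dependence, with coefficients 1 and -1.\<close>

definition independent_on :: "'a list set \<Rightarrow> tm list \<Rightarrow> bool" where
  "independent_on G ts \<longleftrightarrow>
     (\<forall>us\<in>tuples M (length ts). (\<forall>x\<in>G. lin us ts x = \<zero>) \<longrightarrow> set us \<subseteq> {\<zero>})"

text \<open>The new functional is a combination of \<open>k + 1\<close> independent ones. Vanishing
  at the \<open>k\<close> points already chosen means \<open>k\<close> homogeneous equations for its
  coefficients, so there is a nonzero solution, and independence supplies a point of
  \<open>G\<close> where it does not vanish.\<close>

lemma triangular_if_independent:
  assumes G: "G \<subseteq> tuples M n"
    and ind: "\<And>k. \<exists>ts. length ts = k \<and> (\<forall>t\<in>set ts. monomial_tm n t) \<and> independent_on G ts"
  shows "\<exists>L. length L = k \<and> triangular L \<and> (\<forall>Ty\<in>set L. snd Ty \<in> G \<and>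
     (\<exists>us ts. us \<in> tuples M (length ts) \<and> (\<forall>t\<in>set ts. monomial_tm n t) \<and> fst Ty = lin us ts))"
proof (induction k)
  case 0
  show ?case by simp
next
  case (Suc k)
  then obtain L where L: "length L = k" "triangular L" "\<forall>Ty\<in>set L. snd Ty \<in> G \<and>
     (\<exists>us ts. us \<in> tuples M (length ts) \<and> (\<forall>t\<in>set ts. monomial_tm n t) \<and> fst Ty = lin us ts)"
    by blast
  obtain ts where ts: "length ts = Suc k" "\<forall>t\<in>set ts. monomial_tm n t" "independent_on G ts"
    using ind by blast
  let ?row = "\<lambda>y. map (\<lambda>t. tm_at t y) ts"
  have "\<exists>us. length us = Suc k \<and> set us \<subseteq> carrier M \<and> \<not> set us \<subseteq> {\<zero>} \<and>
     (\<forall>r\<in>set (map (\<lambda>Ty. ?row (snd Ty)) L). combine us r = \<zero>)"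
  proof (rule underdetermined_system)
    fix r assume "r \<in> set (map (\<lambda>Ty. ?row (snd Ty)) L)"
    then obtain y where "y \<in> G" "r = ?row y" using L(3) by auto
    then show "length r = Suc k \<and> set r \<subseteq> carrier M" using ts G tm_at_closed[of n _ y] by auto
  qed (use L in simp)
  then obtain us where us: "length us = Suc k" "set us \<subseteq> carrier M" "\<not> set us \<subseteq> {\<zero>}"
    "\<forall>r\<in>set (map (\<lambda>Ty. ?row (snd Ty)) L). combine us r = \<zero>" by (elim exE conjE) (rule that)
  have us_tuple: "us \<in> tuples M (length ts)" using us ts by (simp add: tuples_def)
  then obtain x where x: "x \<in> G" "lin us ts x \<noteq> \<zero>"
    using ts(3) us(3) unfolding independent_on_def by blast
  have "triangular ((lin us ts, x) # L)" using L(2) x(2) us(4) by (simp add: lin_def)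
  then show ?case using L x(1) us_tuple ts(2)
    by (intro exI[of _ "(lin us ts, x) # L"]) auto
qed

section \<open>Algebraically closed parameter sets\<close>

lemma acl_singletonI:
  assumes "definable_pred M A (\<lambda>v. Q (v 0))" "Q b" "b \<in> carrier M"
    "\<And>x. x \<in> carrier M \<Longrightarrow> Q x \<Longrightarrow> x = b"
  shows "b \<in> acl M A"
proof -
  obtain p c where c: "set c \<subseteq> A"
    and p: "\<forall>x. length x = 1 \<longrightarrow> holds M p (x @ c) = Q ((\<lambda>i. if i < 1 then x ! i else \<zero>) 0)"
    using definable_pred_imp_holds[OF assms(1), of 1] by (elim exE conjE) (rule that)
  have p: "holds M p (x # c) = Q x" for x using p[rule_format, of "[x]"] by simp
  have "{x \<in> carrier M. Q x} \<subseteq> {b}" using assms(4) by blast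
  then have "finite {x \<in> carrier M. Q x}" by (rule finite_subset) simp
  then have "finite {x \<in> carrier M. holds M p (x # c)}" by (simp only: p)
  moreover have "holds M p (b # c)" using assms(2) by (simp only: p)
  ultimately show ?thesis using c assms(3) unfolding acl_def by blast
qed

lemma zero_in_acl: "\<zero> \<in> acl M A"
  unfolding acl_def by (auto simp: holds_def intro!: exI[of _ "Eq (Var 0) Zero"] exI[of _ "[]"])

text \<open>All closure properties follow one principle: the only solution of a condition over
  \<open>E\<close> is algebraic over \<open>E\<close>. Inverses and preimages under the shift are
  such solutions.\<close>

lemma dd_subfield_acl_closed:
  assumes E: "acl M E = E" "E \<subseteq> carrier M" shows "dd_subfield E M"
proof -
  have z: "\<zero> \<in> E" using zero_in_acl E(1) by blast
  have in_E: "b \<in> E" if "definable_pred M E (\<lambda>v. Q (v 0))" "Q b" "b \<in> carrier M"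
    "\<And>x. x \<in> carrier M \<Longrightarrow> Q x \<Longrightarrow> x = b" for b Q
    using acl_singletonI[OF that] E(1) by simp
  note tf = term_fun_Var[OF z, of M] term_fun_One[OF z, of M] term_fun_Zero[OF z, of M]
  have p: "term_fun M E (\<lambda>v. x)" if "x \<in> E" for x using that by (rule term_fun_param)
  have eq_E: "b \<in> E" if "term_fun M E (\<lambda>v. b)" "b \<in> carrier M" for b
    by (rule in_E[of "\<lambda>x. x = b"]) (use definable_pred_Eq[OF tf(1) that(1)] that(2) in auto)
  have sub: "subfield E M"
  proof (rule subfieldI'[OF subringI])
    show "E \<subseteq> carrier M" by (rule E(2))
    show "\<one> \<in> E" by (rule eq_E) (use tf in auto)
    fix x y assume xy: "x \<in> E" "y \<in> E"
    show "x \<oplus> y \<in> E" by (rule eq_E[OF term_fun_Plus[OF p p]]) (use xy E(2) in auto)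
    show "x \<otimes> y \<in> E" by (rule eq_E[OF term_fun_Times[OF p p]]) (use xy E(2) in auto)
  next
    fix x assume x: "x \<in> E"
    show "\<ominus> x \<in> E"
    proof (rule in_E[of "\<lambda>y. y \<oplus> x = \<zero>"])
      show "definable_pred M E (\<lambda>v. v 0 \<oplus> x = \<zero>)"
        by (rule definable_pred_Eq[OF term_fun_Plus[OF tf(1) p[OF x]] tf(3)])
      show "y = \<ominus> x" if "y \<in> carrier M" "y \<oplus> x = \<zero>" for y
        using that x E(2) by (metis minus_equality subsetD)
    qed (use x E(2) in \<open>auto simp: l_neg\<close>)
  next
    fix x assume x: "x \<in> E - {\<zero>}"
    then have xc: "x \<in> carrier M" "x \<noteq> \<zero>" using E(2) by auto
    then have ix: "inv x \<in> carrier M" "inv x \<otimes> x = \<one>" by (auto simp: field_Units)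
    show "inv x \<in> E"
    proof (rule in_E[of "\<lambda>y. y \<otimes> x = \<one>"])
      show "definable_pred M E (\<lambda>v. v 0 \<otimes> x = \<one>)"
        using x by (intro definable_pred_Eq[OF term_fun_Times[OF tf(1) p] tf(2)]) simp
      show "y = inv x" if "y \<in> carrier M" "y \<otimes> x = \<one>" for y
        using that xc ix by (metis comm_inv_char m_comm)
    qed (use ix in auto)
  qed
  moreover have "shift M ` E = E"
  proof
    have "shift M x \<in> E" if "x \<in> E" for x
      by (rule eq_E[OF term_fun_Shift[OF p[OF that]]]) (use that E(2) in \<open>auto intro: shift_closed\<close>)
    then show "shift M ` E \<subseteq> E" by blast
    show "E \<subseteq> shift M ` E"
    proof
      fix x assume x: "x \<in> E"
      then obtain y where y: "y \<in> carrier M" "shift M y = x" using shift_image E(2) by (metis imageE subsetD)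
      have "y \<in> E"
      proof (rule in_E[of "\<lambda>y. shift M y = x"])
        show "definable_pred M E (\<lambda>v. shift M (v 0) = x)"
          by (rule definable_pred_Eq[OF term_fun_Shift[OF tf(1)] p[OF x]])
        show "z = y" if "z \<in> carrier M" "shift M z = x" for z
          using that y inj_on_shift by (metis inj_onD)
      qed (use y in auto)
      then show "x \<in> shift M ` E" using y by blast
    qed
  qed
  moreover have "deriv M ` E \<subseteq> E"
  proof -
    have "deriv M x \<in> E" if "x \<in> E" for x
      by (rule eq_E[OF term_fun_Deriv[OF p[OF that]]]) (use that E(2) in \<open>auto intro: deriv_closed\<close>)
    then show ?thesis by blast
  qed
  ultimately show ?thesis by (simp add: dd_subfield_def)
qed

end

lemma (in ring) combine_in_subring:
  assumes "subring K R" "set us \<subseteq> K" "set xs \<subseteq> K" shows "combine us xs \<in> K"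
  using assms(2,3)
  by (induction us xs rule: combine.induct) (auto simp: subringE[OF assms(1)])

section \<open>Maximal independent families and the finite-dimensional case\<close>

context dd_field
begin

text \<open>Maximality is by length, not by inclusion. In this form it passes to any independent
  family of monomials of the same length, notably to the shifted one.\<close>

definition maximal_independent :: "nat \<Rightarrow> 'a list set \<Rightarrow> tm list \<Rightarrow> bool" where
  "maximal_independent n G ts \<longleftrightarrow> (\<forall>t\<in>set ts. monomial_tm n t) \<and> independent_on G ts \<and>
     (\<forall>ts'. length ts' = Suc (length ts) \<longrightarrow> (\<forall>t\<in>set ts'. monomial_tm n t) \<longrightarrow> \<not> independent_on G ts')"

lemma lin_diff:
  assumes "length us = length ts" "length ws = length ts" "set us \<subseteq> carrier M" "set ws \<subseteq> carrier M"
    "\<forall>t\<in>set ts. monomial_tm n t" "x \<in> tuples M n"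
  shows "lin (map2 (\<lambda>u w. u \<ominus> w) us ws) ts x = lin us ts x \<ominus> lin ws ts x"
  using assms(1-5)
proof (induction us ts arbitrary: ws rule: list_induct2)
  case Nil
  then show ?case by (simp add: lin_def minus_eq)
next
  case (Cons u us t ts)
  then obtain w ws' where ws: "ws = w # ws'" by (cases ws) auto
  have c: "u \<in> carrier M" "w \<in> carrier M" "tm_at t x \<in> carrier M"
    "lin us ts x \<in> carrier M" "lin ws' ts x \<in> carrier M"
    using Cons.prems ws assms(6) by (auto intro: tm_at_closed lin_closed)
  have "lin (map2 (\<lambda>u w. u \<ominus> w) us ws') ts x = lin us ts x \<ominus> lin ws' ts x"
    using Cons ws by simp
  moreover have "(u \<ominus> w) \<otimes> tm_at t x \<oplus> (lin us ts x \<ominus> lin ws' ts x) =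
     u \<otimes> tm_at t x \<oplus> lin us ts x \<ominus> (w \<otimes> tm_at t x \<oplus> lin ws' ts x)"
    using c by algebra
  ultimately show ?case by (simp add: ws lin_Cons)
qed

lemma independent_on_unique:
  assumes G: "G \<subseteq> tuples M n" and ts: "\<forall>t\<in>set ts. monomial_tm n t" "independent_on G ts"
    and us: "us \<in> tuples M (length ts)" and ws: "ws \<in> tuples M (length ts)"
    and eq: "\<forall>x\<in>G. lin us ts x = lin ws ts x"
  shows "us = ws"
proof -
  have c: "length us = length ts" "length ws = length ts" "set us \<subseteq> carrier M" "set ws \<subseteq> carrier M"
    using us ws by (auto simp: tuples_def)
  let ?d = "map2 (\<lambda>u w. u \<ominus> w) us ws"
  have "?d \<in> tuples M (length ts)" using c by (auto simp: tuples_def set_zip subset_iff)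
  moreover have "lin ?d ts x = \<zero>" if "x \<in> G" for x
  proof -
    have x: "x \<in> tuples M n" using that G by blast
    then show ?thesis using lin_diff[OF c ts(1) x] lin_closed[OF c(4) ts(1) x] eq that by (simp add: r_neg minus_eq)
  qed
  ultimately have d: "set ?d \<subseteq> {\<zero>}" using ts(2) unfolding independent_on_def by blast
  show ?thesis
  proof (rule nth_equalityI)
    fix i assume i: "i < length us"
    have uw: "us ! i \<in> carrier M" "ws ! i \<in> carrier M" using c i by (auto simp: subset_iff)
    have "?d ! i \<in> set ?d" using c i by (intro nth_mem) simp
    then have "us ! i \<ominus> ws ! i = \<zero>" using d c i by auto
    then show "us ! i = ws ! i" using uw by (simp add: r_right_minus_eq)
  qed (use c in simp)
qed

text \<open>Prepending \<open>t\<close> creates a dependence; the coefficient of \<open>t\<close> in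
  it is nonzero by independence of \<open>ts\<close>, so one can divide by it.\<close>

lemma maximal_independent_spans:
  assumes G: "G \<subseteq> tuples M n" and ts: "maximal_independent n G ts" and t: "monomial_tm n t"
  shows "\<exists>us\<in>tuples M (length ts). \<forall>x\<in>G. tm_at t x = lin us ts x"
proof -
  have mono: "\<forall>t\<in>set ts. monomial_tm n t" and ind: "independent_on G ts"
    using ts by (auto simp: maximal_independent_def)
  have "\<not> independent_on G (t # ts)"
    using ts t unfolding maximal_independent_def by simp
  then obtain vs where vs: "vs \<in> tuples M (Suc (length ts))" "\<forall>x\<in>G. lin vs (t # ts) x = \<zero>" "\<not> set vs \<subseteq> {\<zero>}"
    unfolding independent_on_def by auto
  then obtain u us where us: "vs = u # us" by (cases vs) (auto simp: tuples_def)
  have u: "u \<in> carrier M" and us': "us \<in> tuples M (length ts)" "set us \<subseteq> carrier M" "length us = length ts"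
    using vs(1) us by (auto simp: tuples_def)
  have eq: "u \<otimes> tm_at t x \<oplus> lin us ts x = \<zero>" if "x \<in> G" for x
    using vs(2) that us lin_Cons by metis
  have "u \<noteq> \<zero>"
  proof
    assume "u = \<zero>"
    have "lin us ts x = \<zero>" if "x \<in> G" for x
    proof -
      have "x \<in> tuples M n" using that G by blast
      then have "tm_at t x \<in> carrier M" "lin us ts x \<in> carrier M"
        using t us' mono by (auto intro: tm_at_closed lin_closed)
      then show ?thesis using eq[OF that] \<open>u = \<zero>\<close> by simp
    qed
    then have "set us \<subseteq> {\<zero>}" using ind us'(1) unfolding independent_on_def by blast
    then show False using vs(3) us \<open>u = \<zero>\<close> by simp
  qed
  then have iu: "inv u \<in> carrier M" "inv u \<otimes> u = \<one>" using u by (auto simp: field_Units)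
  let ?k = "\<ominus> (inv u)"
  let ?ws = "map (\<lambda>w. ?k \<otimes> w) us"
  have "?ws \<in> tuples M (length ts)" using us' iu by (auto simp: tuples_def)
  moreover have "tm_at t x = lin ?ws ts x" if "x \<in> G" for x
  proof -
    have x: "x \<in> tuples M n" using that G by blast
    have c: "tm_at t x \<in> carrier M" "lin us ts x \<in> carrier M"
      using t us' mono x by (auto intro: tm_at_closed lin_closed)
    have "lin ?ws ts x = ?k \<otimes> lin us ts x"
    proof -
      have "set (map (\<lambda>t. tm_at t x) ts) \<subseteq> carrier M" using mono x by (auto intro: tm_at_closed)
      then show ?thesis using us'(2) iu(1) unfolding lin_def by (simp add: combine_r_distr)
    qed
    moreover have "lin us ts x = \<ominus> (u \<otimes> tm_at t x)"
      using eq[OF that] c u by (metis m_closed minus_equality minus_minus a_comm)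
    moreover have "?k \<otimes> (\<ominus> (u \<otimes> tm_at t x)) = (inv u \<otimes> u) \<otimes> tm_at t x"
      using c u iu(1) by algebra
    ultimately show ?thesis using iu(2) c by simp
  qed
  ultimately show ?thesis by blast
qed

text \<open>Only the tuple \<open>us\<close> represents \<open>t\<close> on all of \<open>G\<close>,
  and representing \<open>t\<close> is a condition definable over \<open>E\<close>; hence each entry
  is the only element of an \<open>E\<close>-definable set.\<close>

lemma coefficients_in_acl:
  assumes E: "acl M E = E" "E \<subseteq> carrier M"
    and P: "definable_pred M E (\<lambda>v. P (map v [0..<n]))" and G: "G = {x \<in> tuples M n. P x}"
    and ts: "\<forall>t\<in>set ts. monomial_tm n t" "independent_on G ts" and t: "monomial_tm n t"
    and us: "us \<in> tuples M (length ts)" "\<forall>x\<in>G. tm_at t x = lin us ts x"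
  shows "set us \<subseteq> E"
proof -
  define m where "m = length ts"
  have z: "\<zero> \<in> E" using zero_in_acl E(1) by blast
  have Gt: "G \<subseteq> tuples M n" using G by auto
  have len: "length us = m" using us by (simp add: tuples_def m_def)
  \<comment> \<open>\<open>R\<close> states that the representation fails at \<open>x\<close>. Its
    negated existential closure expresses the universal quantifier over \<open>G\<close>.\<close>
  define R where "R x ws \<longleftrightarrow> P x \<and> tm_at t x \<noteq> lin ws ts x" for x ws
  have R: "definable_pred M E (\<lambda>v. R (map v [0..<n]) (map v [n..<n + m]))"
  proof -
    have "term_fun M E (\<lambda>v. combine (map (\<lambda>F. F v) (map (\<lambda>i v. v i) [n..<n + m]))
       (map (\<lambda>H. H v) (map (\<lambda>t v. tm_val M v t) ts)))"
      using term_fun_Var[OF z, of M] term_fun_tm[OF z, of M id] by (intro term_fun_combine[OF _ z]) (auto simp: m_def)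
    moreover have "lin (map v [n..<n + m]) ts (map v [0..<n]) =
       combine (map (\<lambda>F. F v) (map (\<lambda>i v. v i) [n..<n + m])) (map (\<lambda>H. H v) (map (\<lambda>t v. tm_val M v t) ts))" for v
      using ts(1) by (simp add: lin_def comp_def tm_at_map cong: map_cong)
    ultimately have 1: "term_fun M E (\<lambda>v. lin (map v [n..<n + m]) ts (map v [0..<n]))" by simp
    have 2: "term_fun M E (\<lambda>v. tm_at t (map v [0..<n]))"
      using term_fun_tm[OF z, of M id t] tm_at_map[OF t] by simp
    show ?thesis unfolding R_def
      by (rule definable_pred_And[OF P definable_pred_Not[OF definable_pred_Eq[OF 2 1]]])
  qed
  have "definable_pred M E (\<lambda>v. \<exists>x\<in>tuples M n. R x (map (\<lambda>i. if 0 \<le> i \<and> i < 0 + n then x ! (i - 0) else v i) [n..<n + m]))"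
    by (rule definable_pred_Exists_block[of M E "\<lambda>x v. R x (map v [n..<n + m])" 0 n]) (use R in simp)
  moreover have "map (\<lambda>i. if 0 \<le> i \<and> i < 0 + n then x ! (i - 0) else v i) [n..<n + m] = map v [n..<n + m]"
    for x and v :: "nat \<Rightarrow> 'a" by (rule map_cong) auto
  ultimately have "definable_pred M E (\<lambda>v. \<exists>x\<in>tuples M n. R x (map v [n..<n + m]))" by (simp only:)
  then have N: "definable_pred M E (\<lambda>v. \<not> (\<exists>x\<in>tuples M n. R x (map v [n..<n + m])))"
    by (rule definable_pred_Not)
  have unique: "ws = us" if "ws \<in> tuples M m" "\<not> (\<exists>x\<in>tuples M n. R x ws)" for ws
  proof (rule independent_on_unique[OF Gt ts])
    show "\<forall>x\<in>G. lin ws ts x = lin us ts x"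
    proof
      fix x assume x: "x \<in> G"
      then have "x \<in> tuples M n" "P x" using G by auto
      then have "tm_at t x = lin ws ts x" using that(2) unfolding R_def by blast
      then show "lin ws ts x = lin us ts x" using us(2) x by simp
    qed
  qed (use that(1) us(1) in \<open>auto simp: m_def\<close>)
  have "us ! i \<in> E" if i: "i < m" for i
  proof -
    \<comment> \<open>Variables below \<open>n\<close> carry the point, the next \<open>m\<close>
      the coefficients, and variable \<open>n + m\<close> the value of the \<open>i\<close>-th one;
      \<open>?f\<close> moves this last variable to 0.\<close>
    let ?f = "\<lambda>j. if j = n + m then 0 else Suc j"
    let ?Q = "\<lambda>ws. \<not> (\<exists>x\<in>tuples M n. R x ws)"
    have "definable_pred M E (\<lambda>v. ?Q (map v [n..<n + m]) \<and> v (n + i) = v (n + m))"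
      by (rule definable_pred_And[OF N definable_pred_Eq[OF term_fun_Var[OF z] term_fun_Var[OF z]]])
    then have "definable_pred M E (\<lambda>v. ?Q (map v [n..<n + m]) \<and> map v [n..<n + m] ! i = v (n + m))"
      using i by simp
    from definable_pred_Exists_block[of M E "\<lambda>ws v. ?Q ws \<and> ws ! i = v (n + m)" n m, OF this]
    have "definable_pred M E (\<lambda>v. \<exists>ws\<in>tuples M m. ?Q ws \<and> ws ! i = v (n + m))" by simp
    moreover have "inj ?f" by (auto simp: inj_def)
    ultimately have "definable_pred M E (\<lambda>v. \<exists>ws\<in>tuples M m. ?Q ws \<and> ws ! i = (v \<circ> ?f) (n + m))"
      by (rule definable_pred_rename)
    moreover have "(v \<circ> ?f) (n + m) = v 0" for v :: "nat \<Rightarrow> 'a" by simp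
    ultimately have def: "definable_pred M E (\<lambda>v. \<exists>ws\<in>tuples M m. ?Q ws \<and> ws ! i = v 0)" by (simp only:)
    have "us ! i \<in> acl M E"
    proof (rule acl_singletonI[of E "\<lambda>z. \<exists>ws\<in>tuples M m. ?Q ws \<and> ws ! i = z"])
      show "definable_pred M E (\<lambda>v. \<exists>ws\<in>tuples M m. ?Q ws \<and> ws ! i = v 0)" by (rule def)
      have "?Q us" using us(2) G unfolding R_def by auto
      then show "\<exists>ws\<in>tuples M m. ?Q ws \<and> ws ! i = us ! i" using us(1) m_def by blast
      show "us ! i \<in> carrier M" using us(1) i len by (auto simp: tuples_def subset_iff)
    next
      fix y assume "\<exists>ws\<in>tuples M m. ?Q ws \<and> ws ! i = y"
      then obtain ws where "ws \<in> tuples M m" "?Q ws" "ws ! i = y" by (elim bexE conjE) (rule that)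
      then show "y = us ! i" using unique by simp
    qed
    then show ?thesis using E(1) by simp
  qed
  then show ?thesis using len by (auto simp: in_set_conv_nth)
qed

lemma shift_inv: "x \<in> carrier M \<Longrightarrow> x \<noteq> \<zero> \<Longrightarrow> shift M (inv x) = inv (shift M x) \<and> shift M x \<noteq> \<zero>"
proof -
  assume x: "x \<in> carrier M" "x \<noteq> \<zero>"
  then have i: "inv x \<in> carrier M" "inv x \<otimes> x = \<one>" by (auto simp: field_Units)
  then have e: "shift M (inv x) \<otimes> shift M x = \<one>" using shift_mult[of "inv x" x] x shift_one by simp
  then have "inv (shift M x) = shift M (inv x)"
    using x i shift_closed by (metis comm_inv_char m_comm)
  moreover have "shift M x \<noteq> \<zero>" using inj_on_shift shift_zero x by (metis inj_onD zero_closed)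
  ultimately show ?thesis by simp
qed

lemma shift_a_inv: "x \<in> carrier M \<Longrightarrow> shift M (\<ominus> x) = \<ominus> shift M x"
  using shift_add[of "\<ominus> x" x] shift_zero shift_closed by (metis a_inv_closed l_neg minus_equality)

lemma deriv_a_inv: "x \<in> carrier M \<Longrightarrow> deriv M (\<ominus> x) = \<ominus> deriv M x"
  using deriv_add[of "\<ominus> x" x] deriv_zero deriv_closed by (metis a_inv_closed l_neg minus_equality)

lemma deriv_one: "deriv M \<one> = \<zero>"
  using deriv_mult[of \<one> \<one>] deriv_closed[of \<one>] by (intro zero_if_idempotent) auto

text \<open>Differentiate \<open>inv x\<close> times \<open>x\<close> equal to 1, then multiply by
  \<open>inv x\<close>.\<close>

lemma deriv_inv:
  assumes x: "x \<in> carrier M" "x \<noteq> \<zero>"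
  shows "deriv M (inv x) = \<ominus> (deriv M x \<otimes> (inv x \<otimes> inv x))"
proof -
  have i: "inv x \<in> carrier M" "inv x \<otimes> x = \<one>" using x by (auto simp: field_Units)
  have d: "deriv M x \<in> carrier M" "deriv M (inv x) \<in> carrier M" using x i deriv_closed by auto
  have e: "deriv M (inv x) \<otimes> x \<oplus> inv x \<otimes> deriv M x = \<zero>"
    using deriv_mult[OF i(1) x(1)] i(2) deriv_one by simp
  have "deriv M (inv x) \<oplus> deriv M x \<otimes> (inv x \<otimes> inv x) = \<zero>"
  proof -
    have "deriv M (inv x) \<otimes> (inv x \<otimes> x) \<oplus> deriv M x \<otimes> (inv x \<otimes> inv x) =
        (deriv M (inv x) \<otimes> x \<oplus> inv x \<otimes> deriv M x) \<otimes> inv x"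
      using x(1) i(1) d by algebra
    then show ?thesis using i d e by simp
  qed
  then show ?thesis using i d by (metis m_closed minus_equality)
qed

lemma lin_map_Shift:
  assumes "length us = length ts" "set us \<subseteq> carrier M" "\<forall>t\<in>set ts. monomial_tm n t" "x \<in> tuples M n"
  shows "lin (map (shift M) us) (map Shift ts) x = shift M (lin us ts x)"
  using assms(1-3)
proof (induction us ts rule: list_induct2)
  case Nil
  then show ?case by (simp add: lin_def shift_zero)
next
  case (Cons u us t ts)
  have "u \<in> carrier M" "tm_at t x \<in> carrier M" "lin us ts x \<in> carrier M"
    using Cons.prems assms(4) by (auto intro: tm_at_closed lin_closed)
  then show ?case using Cons by (simp add: lin_Cons tm_at_Shift shift_add shift_mult)
qed

text \<open>Applying the inverse shift to the coefficients turns a relation among the shifted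
  monomials into one among the original ones.\<close>

lemma maximal_independent_map_Shift:
  assumes G: "G \<subseteq> tuples M n" and ts: "maximal_independent n G ts"
  shows "maximal_independent n G (map Shift ts)"
proof -
  have mono: "\<forall>t\<in>set ts. monomial_tm n t" and ind: "independent_on G ts"
    using ts by (auto simp: maximal_independent_def)
  have "independent_on G (map Shift ts)"
    unfolding independent_on_def
  proof (intro ballI impI)
    fix us assume us: "us \<in> tuples M (length (map Shift ts))" "\<forall>x\<in>G. lin us (map Shift ts) x = \<zero>"
    define ws where "ws = map (inv_into (carrier M) (shift M)) us"
    have usc: "set us \<subseteq> shift M ` carrier M" using us by (simp add: tuples_def shift_image)
    have ws: "set ws \<subseteq> carrier M" "length ws = length ts"
      using usc us(1) by (auto simp: ws_def tuples_def intro: inv_into_into)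
    have us_eq: "us = map (shift M) ws"
      using usc by (auto simp: ws_def f_inv_into_f subset_iff intro!: map_idI[symmetric])
    have "lin ws ts x = \<zero>" if "x \<in> G" for x
    proof -
      have x: "x \<in> tuples M n" using that G by blast
      have "shift M (lin ws ts x) = shift M \<zero>"
        using lin_map_Shift[OF ws(2,1) mono x] us(2) that us_eq shift_zero by simp
      then show ?thesis using lin_closed[OF ws(1) mono x] inj_on_shift by (metis inj_onD zero_closed)
    qed
    then have "set ws \<subseteq> {\<zero>}" using ind ws unfolding independent_on_def by (auto simp: tuples_def)
    then show "set us \<subseteq> {\<zero>}" using us_eq shift_zero by auto
  qed
  then show ?thesis using ts by (auto simp: maximal_independent_def intro: monomial_tm.Shift)
qed

text \<open>The field \<open>L\<close> generated over \<open>E\<close> by the values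
  \<open>S\<close> of the family at \<open>a\<close> is stable under shift, inverse shift and
  derivation, so it contains the difference-differential field generated by \<open>E\<close> and
  \<open>a\<close>.\<close>

lemma finite_dimensional_if_maximal_independent:
  assumes E: "acl M E = E" "E \<subseteq> carrier M"
    and P: "definable_pred M E (\<lambda>v. P (map v [0..<n]))" and G: "G = {x \<in> tuples M n. P x}"
    and ts: "maximal_independent n G ts" and a: "a \<in> G"
  shows "finite_dimensional_tuple M E a"
proof -
  have Gt: "G \<subseteq> tuples M n" using G by auto
  have at: "a \<in> tuples M n" using a Gt by blast
  have ddE: "dd_subfield E M" using dd_subfield_acl_closed[OF E] .
  then have Esub: "subfield E M" and Eshift: "shift M ` E = E" and Ederiv: "deriv M ` E \<subseteq> E"
    by (auto simp: dd_subfield_def)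
  have span: "\<exists>us. set us \<subseteq> E \<and> length us = length ts' \<and> (\<forall>x\<in>G. tm_at t x = lin us ts' x)"
    if asm: "maximal_independent n G ts'" "monomial_tm n t" for ts' t
  proof -
    have m: "\<forall>t\<in>set ts'. monomial_tm n t" "independent_on G ts'" using asm(1) by (auto simp: maximal_independent_def)
    obtain us where us: "us \<in> tuples M (length ts')" "\<forall>x\<in>G. tm_at t x = lin us ts' x"
      using maximal_independent_spans[OF Gt asm] by blast
    have "set us \<subseteq> E" by (rule coefficients_in_acl[OF E P G m asm(2) us])
    then show ?thesis using us by (auto simp: tuples_def)
  qed
  have mono: "\<forall>t\<in>set ts. monomial_tm n t" using ts by (auto simp: maximal_independent_def)
  define S where "S = (\<lambda>t. tm_at t a) ` set ts"
  define L where "L = generate_field M (E \<union> S)"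
  have S: "S \<subseteq> carrier M" using mono at by (auto simp: S_def intro: tm_at_closed)
  have L: "subfield L M" unfolding L_def using S E(2) by (intro generate_field_is_subfield) auto
  have Lsub: "subring L M" using subfieldE(1)[OF L] .
  have Lc: "L \<subseteq> carrier M" using subfieldE(3)[OF L] .
  have EL: "E \<subseteq> L" and SL: "S \<subseteq> L" by (auto simp: L_def intro: generate_field.incl)
  have lin_L: "lin us ts a \<in> L" if "set us \<subseteq> E" for us
    unfolding lin_def using that EL SL by (intro combine_in_subring[OF Lsub]) (auto simp: S_def)
  \<comment> \<open>Words of any length take values in \<open>L\<close>, because their coefficients
    with respect to \<open>ts\<close> lie in \<open>E\<close>.\<close>
  have tm_L: "tm_at t a \<in> L" if "monomial_tm n t" for t
  proof -
    obtain us where "set us \<subseteq> E" "\<forall>x\<in>G. tm_at t x = lin us ts x" using span[OF ts \<open>monomial_tm n t\<close>] by blast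
    then show ?thesis using lin_L a by auto
  qed
  have Linv: "inv h \<in> L" if "h \<in> L" "h \<noteq> \<zero>" for h
    using that subfield_m_inv(1)[OF L] by auto
  have shift_L: "shift M h \<in> L" if "h \<in> L" for h
    using that[unfolded L_def]
  proof induction
    case one
    then show ?case using subringE(3)[OF Lsub] by (simp add: shift_one)
  next
    case (incl h)
    then consider "h \<in> E" | t where "t \<in> set ts" "h = tm_at t a" by (auto simp: S_def)
    then show ?case
    proof cases
      case 1
      then show ?thesis using Eshift EL by blast
    next
      case 2
      then show ?thesis using tm_L[of "Shift t"] mono by (auto simp: tm_at_Shift intro: monomial_tm.Shift)
    qed
  next
    case (a_inv h)
    then show ?case using Lc subringE(5)[OF Lsub] by (auto simp: shift_a_inv L_def[symmetric] subset_iff)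
  next
    case (m_inv h)
    then have "h \<in> carrier M" using Lc by (auto simp: L_def)
    then show ?case using m_inv shift_inv[of h] Linv[of "shift M h"] by simp
  next
    case (eng_add h1 h2)
    then have "h1 \<in> carrier M" "h2 \<in> carrier M" using Lc by (auto simp: L_def)
    then show ?case using eng_add subringE(7)[OF Lsub] by (simp add: shift_add)
  next
    case (eng_mult h1 h2)
    then have "h1 \<in> carrier M" "h2 \<in> carrier M" using Lc by (auto simp: L_def)
    then show ?case using eng_mult subringE(6)[OF Lsub] by (simp add: shift_mult)
  qed
  have deriv_L: "deriv M h \<in> L" if "h \<in> L" for h
    using that[unfolded L_def]
  proof induction
    case one
    then show ?case using subringE(2)[OF Lsub] by (simp add: deriv_one)
  next
    case (incl h)
    then consider "h \<in> E" | t where "t \<in> set ts" "h = tm_at t a" by (auto simp: S_def)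
    then show ?case
    proof cases
      case 1
      then show ?thesis using Ederiv EL by blast
    next
      case 2
      then show ?thesis using tm_L[of "Deriv t"] mono by (auto simp: tm_at_Deriv intro: monomial_tm.Deriv)
    qed
  next
    case (a_inv h)
    then have "h \<in> carrier M" using Lc by (auto simp: L_def)
    then show ?case using a_inv subringE(5)[OF Lsub] by (simp add: deriv_a_inv)
  next
    case (m_inv h)
    then have h: "h \<in> L" "h \<in> carrier M" using Lc by (auto simp: L_def)
    then show ?case using m_inv Linv[OF h(1)] subringE(5,6)[OF Lsub] by (simp add: deriv_inv)
  next
    case (eng_add h1 h2)
    then have "h1 \<in> carrier M" "h2 \<in> carrier M" using Lc by (auto simp: L_def)
    then show ?case using eng_add subringE(7)[OF Lsub] by (simp add: deriv_add)
  next
    case (eng_mult h1 h2)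
    then have "h1 \<in> L" "h2 \<in> L" "h1 \<in> carrier M" "h2 \<in> carrier M" using Lc by (auto simp: L_def)
    then show ?case using eng_mult subringE(6,7)[OF Lsub] by (simp add: deriv_mult)
  qed
  \<comment> \<open>Here the shifted family does the spanning: a monomial is a combination of the
    \<open>Shift\<close> terms with coefficients in \<open>E\<close>, and the values of these terms
    at \<open>a\<close> as well as the coefficients are shifts of elements of
    \<open>L\<close>.\<close>
  have unshift_L: "h \<in> shift M ` L" if "h \<in> L" for h
    using that[unfolded L_def]
  proof induction
    case one
    then show ?case using subringE(3)[OF Lsub] shift_one by (metis imageI)
  next
    case (incl h)
    then consider "h \<in> E" | t where "t \<in> set ts" "h = tm_at t a" by (auto simp: S_def)
    then show ?case
    proof cases
      case 1
      then show ?thesis using Eshift EL by blast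
    next
      case 2
      then obtain us where us: "set us \<subseteq> E" "length us = length ts"
        "\<forall>x\<in>G. tm_at t x = lin us (map Shift ts) x"
        using span[OF maximal_independent_map_Shift[OF Gt ts], of t] mono by auto
      define ws where "ws = map (inv_into E (shift M)) us"
      have "set us \<subseteq> shift M ` E" using us(1) Eshift by simp
      then have ws: "set ws \<subseteq> E" "length ws = length ts"
        using us(2) by (auto simp: ws_def intro: inv_into_into)
      have "us = map (shift M) ws"
        using \<open>set us \<subseteq> shift M ` E\<close> by (auto simp: ws_def f_inv_into_f subset_iff intro!: map_idI[symmetric])
      then have "h = shift M (lin ws ts a)"
        using us(3) a 2(2) lin_map_Shift[OF ws(2) subset_trans[OF ws(1) E(2)] mono at] by simp
      then show ?thesis using lin_L[OF ws(1)] by blast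
    qed
  next
    case (a_inv h)
    then obtain z where "z \<in> L" "h = shift M z" by blast
    then show ?case using subringE(5)[OF Lsub] Lc by (metis imageI shift_a_inv subsetD)
  next
    case (m_inv h)
    then obtain z where z: "z \<in> L" "h = shift M z" by blast
    then have "z \<noteq> \<zero>" using m_inv shift_zero by auto
    then have "inv h = shift M (inv z)" "inv z \<in> L" using z Linv shift_inv Lc by auto
    then show ?case by blast
  next
    case (eng_add h1 h2)
    then obtain z1 z2 where "z1 \<in> L" "h1 = shift M z1" "z2 \<in> L" "h2 = shift M z2" by blast
    moreover from this have "z1 \<in> carrier M" "z2 \<in> carrier M" using Lc by auto
    ultimately have "h1 \<oplus> h2 = shift M (z1 \<oplus> z2)" "z1 \<oplus> z2 \<in> L" using shift_add subringE(7)[OF Lsub] Lc by auto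
    then show ?case by blast
  next
    case (eng_mult h1 h2)
    then obtain z1 z2 where "z1 \<in> L" "h1 = shift M z1" "z2 \<in> L" "h2 = shift M z2" by blast
    moreover from this have "z1 \<in> carrier M" "z2 \<in> carrier M" using Lc by auto
    ultimately have "h1 \<otimes> h2 = shift M (z1 \<otimes> z2)" "z1 \<otimes> z2 \<in> L" using shift_mult subringE(6)[OF Lsub] Lc by auto
    then show ?case by blast
  qed
  have "dd_subfield L M" unfolding dd_subfield_def using L shift_L deriv_L unshift_L by auto
  moreover have "set a \<subseteq> L"
  proof
    fix y assume "y \<in> set a"
    then obtain l where "l < n" "y = a ! l" using at by (auto simp: tuples_def in_set_conv_nth)
    then show "y \<in> L" using tm_L[OF monomial_tm.Var, of l] by (simp add: tm_at_def)
  qed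
  ultimately have gen: "dd_generated M (E \<union> set a) \<subseteq> L" using EL unfolding dd_generated_def by blast
  \<comment> \<open>The transcendence basis has to lie in the generated field itself, so its
    candidates \<open>S\<close> must.\<close>
  have "S \<subseteq> dd_generated M (E \<union> set a)"
  proof -
    have "tm_at t a \<in> K" if "dd_subfield K M" "E \<union> set a \<subseteq> K" "monomial_tm n t" for K t
      using that(3)
    proof induction
      case (Var l)
      then have "a ! l \<in> set a" using at by (auto simp: tuples_def)
      then show ?case using that by (auto simp: tm_at_def)
    next
      case (Shift t)
      then show ?case using that(1) by (auto simp: tm_at_Shift dd_subfield_def)
    next
      case (Deriv t)
      then show ?case using that(1) by (auto simp: tm_at_Deriv dd_subfield_def)
    qed
    then show ?thesis using mono unfolding S_def dd_generated_def by blast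
  qed
  moreover have "finite S" by (simp add: S_def)
  ultimately show ?thesis
    unfolding finite_dimensional_tuple_def
    using finite_trdeg_if_finitely_generated[OF Esub _ _ _ subset_trans[OF gen Lc]] gen by (simp add: L_def)
qed

text \<open>The coefficients \<open>F\<close> of the functionals may lie outside \<open>E\<close>,
  so the rank is bounded below over \<open>F \<union> E\<close> first, and the bound then descends
  to \<open>E\<close>.\<close>

lemma SU_ge_at_in_subgroup:
  assumes sat: "saturated M" and E: "acl M E = E" "small M E"
    and P: "definable_pred M E (\<lambda>v. P (map v [0..<n]))" and G: "G = {x \<in> tuples M n. P x}"
    and grp: "subgroup G (Ga_power M n)"
    and ind: "\<And>k. \<exists>ts. length ts = k \<and> (\<forall>t\<in>set ts. monomial_tm n t) \<and> independent_on G ts"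
  shows "\<exists>b\<in>G. SU_ge_at M natLeq k E b"
proof -
  have Gt: "G \<subseteq> tuples M n" using G by auto
  have add: "tuple_add x y \<in> G" if "x \<in> G" "y \<in> G" for x y
    using subgroup.m_closed[OF grp that] by (simp add: Ga_power_def tuple_add_def)
  have z: "replicate n \<zero> \<in> G" using subgroup.one_closed[OF grp] by (simp add: Ga_power_def)
  obtain L where L: "length L = k" "triangular L" "\<forall>Ty\<in>set L. snd Ty \<in> G \<and>
     (\<exists>us ts. us \<in> tuples M (length ts) \<and> (\<forall>t\<in>set ts. monomial_tm n t) \<and> fst Ty = lin us ts)"
    using triangular_if_independent[OF Gt ind] by blast
  then obtain us ts where ut: "\<And>Ty. Ty \<in> set L \<Longrightarrow> us Ty \<in> tuples M (length (ts Ty)) \<and>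
     (\<forall>t\<in>set (ts Ty). monomial_tm n t) \<and> fst Ty = lin (us Ty) (ts Ty)" by metis
  define F where "F = (\<Union>Ty\<in>set L. set (us Ty))"
  have F: "finite F" "F \<subseteq> carrier M" using ut by (auto simp: F_def tuples_def)
  have "\<exists>a\<in>tuples M n. P a \<and> SU_ge_at M natLeq (length L) (F \<union> E) a"
  proof (rule SU_ge_at_of_triangular[OF sat])
    show "small M (F \<union> E)" by (rule small_Un_finite[OF F E(2) infinite_carrier])
    show zE: "\<zero> \<in> F \<union> E" using zero_in_acl E(1) by blast
    show "definable_pred M (F \<union> E) (\<lambda>v. P (map v [0..<n]))" by (rule definable_pred_mono[OF P]) simp
    show "replicate n \<zero> \<in> tuples M n" "P (replicate n \<zero>)" using z G by auto
    show "triangular L" by (rule L(2))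
    fix T y assume Ty: "(T, y) \<in> set L"
    note u = ut[OF Ty]
    have len: "length (us (T, y)) = length (ts (T, y))" "set (us (T, y)) \<subseteq> carrier M"
      using u by (auto simp: tuples_def)
    have T: "T = lin (us (T, y)) (ts (T, y))" using u by simp
    have "set (us (T, y)) \<subseteq> F \<union> E" using Ty by (auto simp: F_def)
    then have "term_fun M (F \<union> E) (\<lambda>v. lin (us (T, y)) (ts (T, y)) (map v [0..<n]))"
      using u by (intro term_fun_lin[OF len(1) zE]) auto
    moreover have "additive_functional n (lin (us (T, y)) (ts (T, y)))"
      using u by (intro additive_functional_lin[OF len]) auto
    moreover have "y \<in> G" using L(3) Ty by auto
    ultimately show "term_fun M (F \<union> E) (\<lambda>v. T (map v [0..<n])) \<and> additive_functional n T \<and> y \<in> tuples M n"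
      using T Gt by auto
    show "P (tuple_add x y)" if "x \<in> tuples M n" "P x" for x
      using add[of x y] that \<open>y \<in> G\<close> G by auto
  qed
  then obtain a where "a \<in> G" "SU_ge_at M natLeq k (F \<union> E) a" using G L(1) by blast
  then show ?thesis using SU_ge_at_natLeq_anti_mono[of M k "F \<union> E" a E] by blast
qed

end

theorem lemma3p4p32:
  fixes U :: "'a dd_ring" and n :: nat and E :: "'a set" and G :: "'a list set"
  assumes "DCFA_model U" and "saturated U"
    and "small U E" and "acl U E = E"
    and "definable_over U n E G" and "subgroup G (Ga_power U n)"
    and "infinite_dimensional U E G"
  shows "group_SU_ge U natLeq E G"
proof -
  interpret dd_field U using assms(1) by (simp add: DCFA_model_def)
  have E: "E \<subseteq> carrier U" using assms(3) by (simp add: small_def)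
  have z: "\<zero>\<^bsub>U\<^esub> \<in> E" using zero_in_acl assms(4) by blast
  obtain p c where c: "set c \<subseteq> E" and G: "G = {a \<in> tuples U n. holds U p (a @ c)}"
    using assms(5) by (auto simp: definable_over_def)
  have P: "definable_pred U E (\<lambda>v. holds U p (map v [0..<n] @ c))" by (rule definable_pred_holds[OF c z])
  obtain a where a: "generic U E G a" "\<not> finite_dimensional_tuple U E a"
    using assms(7) by (auto simp: infinite_dimensional_def)
  have "a \<in> G" using a(1) by (simp add: generic_def)
  \<comment> \<open>A single infinite-dimensional point of \<open>G\<close> excludes a maximal
    independent family of any length.\<close>
  have no_max: "\<not> maximal_independent n G ts" for ts
    using finite_dimensional_if_maximal_independent[OF assms(4) E P G _ \<open>a \<in> G\<close>] a(2) by blast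
  \<comment> \<open>As no length is maximal, an independent family of length \<open>k\<close> is
    followed by one of length \<open>Suc k\<close>, which need not extend it.\<close>
  have "\<exists>ts. length ts = k \<and> (\<forall>t\<in>set ts. monomial_tm n t) \<and> independent_on G ts" for k
  proof (induction k)
    case 0
    have "independent_on G []" by (auto simp: independent_on_def tuples_def)
    then show ?case by auto
  next
    case (Suc k)
    then obtain ts where "length ts = k" "\<forall>t\<in>set ts. monomial_tm n t" "independent_on G ts" by blast
    then show ?case using no_max[of ts] unfolding maximal_independent_def by auto
  qed
  then have "\<exists>b\<in>G. SU_ge_at U natLeq k E b" for k
    by (rule SU_ge_at_in_subgroup[OF assms(2,4,3) P G assms(6)])
  moreover have "infinite (UNIV :: 'a set)" using infinite_carrier by (meson finite_subset top_greatest)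
  ultimately have "SU_ge U natLeq E a" using SU_ge_natLeq_if_generic[OF a(1)] by blast
  then show ?thesis using a(1) by (auto simp: group_SU_ge_def)
qed

end
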